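(* There is an absolute constant $c>0$ such that the following holds. Let $p \geq 2$ and $d \geq 1$ be an integer. Then for every $n$-point subset $\mathcal{C} \subset \ell_p^d$ (equipped with the $\ell_p$ metric) and every $\Delta>0$, there exists a $(\beta,\Delta)$-Lipschitz decomposition of $\mathcal{C}$ with $\beta = c\, p^4\sqrt{\min\{\log n, d\}}$.
   Context: Let $(\mathcal{M},d_\mathcal{M})$ be a metric space. A distribution $\mathcal{D}$ over partitions of $\mathcal{M}$ is a $(\beta,\Delta)$-Lipschitz decomposition if (i) for every partition $P$ in the support of $\mathcal{D}$, every cluster $C\in P$ has $\operatorname{diam}(C)=\sup_{x,y\in C} d_\mathcal{M}(x,y)\le \Delta$; and (ii) for every $x,y\in\mathcal{M}$, $\Pr_{P\sim\mathcal{D}}[P(x)\ne P(y)]\le \beta\, d_\mathcal{M}(x,y)/\Delta$, where $P(z)$ is the cluster of $P$ containing $z$. The space $\ell_p^d$ is $\mathbb{R}^d$ with the norm $\|x\|_p=(\sum_i |x_i|^p)^{1/p}$. *)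

theory Defs
  imports "HOL-Probability.Probability" "HOL-Library.Disjoint_Sets"
begin

text \<open>The l_p distance on R^d, where points of R^d are represented as functions
  nat => real that vanish outside the index set {..<d}.\<close>
definition lp_dist :: "real \<Rightarrow> nat \<Rightarrow> (nat \<Rightarrow> real) \<Rightarrow> (nat \<Rightarrow> real) \<Rightarrow> real" where
  "lp_dist p d x y = (\<Sum>i<d. \<bar>x i - y i\<bar> powr p) powr (1 / p)"

definition real_space :: "nat \<Rightarrow> (nat \<Rightarrow> real) set" where
  "real_space d = {x. \<forall>i\<ge>d. x i = 0}"

definition set_diam :: "('a \<Rightarrow> 'a \<Rightarrow> real) \<Rightarrow> 'a set \<Rightarrow> real" where
  "set_diam dst A = (SUP xy\<in>A \<times> A. dst (fst xy) (snd xy))"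

definition cluster :: "'a set set \<Rightarrow> 'a \<Rightarrow> 'a set" where
  "cluster P z = (THE A. A \<in> P \<and> z \<in> A)"

definition lipschitz_decomposition ::
  "('a \<Rightarrow> 'a \<Rightarrow> real) \<Rightarrow> 'a set \<Rightarrow> real \<Rightarrow> real \<Rightarrow> 'a set set pmf \<Rightarrow> bool" where
  "lipschitz_decomposition dst M \<beta> \<Delta> D \<longleftrightarrow>
     (\<forall>P\<in>set_pmf D. partition_on M P \<and> (\<forall>C\<in>P. set_diam dst C \<le> \<Delta>)) \<and>
     (\<forall>x\<in>M. \<forall>y\<in>M. measure_pmf.prob D {P. cluster P x \<noteq> cluster P y} \<le> \<beta> * dst x y / \<Delta>)"

end

theory Submission
  imports Defs
begin

text \<open>
  A partition is replaced by a fractional object, a nonnegative weight on subsets of \<open>C\<close>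
  in which every point is covered with total weight 1; the defect of the joint covering weight of
  \<open>x\<close> and \<open>y\<close> plays the role of the separation probability. Under refinement these defects
  add up, with no loss of constants, and repeatedly carving out a random set that meets the remaining
  points turns a cover into a random partition at the cost of a factor 2.

  In Euclidean space of dimension \<open>k\<close> every coordinate is spread over the two neighbouring
  integers with weights \<open>cos\<^sup>2\<close> and \<open>sin\<^sup>2\<close>. Hellinger affinities of product
  weights multiply, so the defect is \<open>O(\<parallel>x - y\<parallel>\<^sub>2)\<close>, while sets have diameter at most
  \<open>2 \<surd>k\<close>. For \<open>n\<close> points a matrix of random signs with \<open>O(log n)\<close> rows
  separates all distant pairs in some coordinate, which replaces \<open>d\<close> by \<open>log n\<close>.

  The passage from \<open>p/2\<close> to \<open>p\<close> uses the Mazur map \<open>a \<mapsto> a\<bar>a\<bar>\<close>. On a set of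
  diameter \<open>2\<Delta>\<close> it loses a factor 8. Starting from a trivial cover at a huge scale and halving
  the scale, the defects form a geometric series, which gives a factor 16 each time \<open>p\<close> doubles,
  hence \<open>p\<^sup>4\<close>.
\<close>

section \<open>Stochastic covers\<close>

text \<open>The total mass of \<open>W\<close> is left free and may exceed 1, so this is in general
  not a probability. Only the mass through each single point gets normalised, in
  \<open>stochastic_cover\<close>.\<close>

definition joint_weight :: "('a set \<Rightarrow> real) \<Rightarrow> 'a set \<Rightarrow> 'a \<Rightarrow> 'a \<Rightarrow> real" where
  "joint_weight W C x y = (\<Sum>S\<in>Pow C. W S * of_bool (x \<in> S \<and> y \<in> S))"

text \<open>Sets of positive weight may overlap. \<open>Q\<close> will bound their diameter;
  \<open>e\<close> bounds the defect, which is later turned into a separation probability.\<close>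

definition stochastic_cover ::
  "'a set \<Rightarrow> ('a set \<Rightarrow> bool) \<Rightarrow> ('a \<Rightarrow> 'a \<Rightarrow> real) \<Rightarrow> ('a set \<Rightarrow> real) \<Rightarrow> bool" where
  "stochastic_cover C Q e W \<longleftrightarrow>
     (\<forall>S. W S \<ge> 0) \<and> (\<forall>S. W S \<noteq> 0 \<longrightarrow> S \<subseteq> C \<and> Q S) \<and>
     (\<forall>x\<in>C. joint_weight W C x x = 1) \<and>
     (\<forall>x\<in>C. \<forall>y\<in>C. joint_weight W C x y \<ge> 1 - e x y)"

lemma stochastic_coverD:
  assumes "stochastic_cover C Q e W"
  shows "W S \<ge> 0" "W S \<noteq> 0 \<Longrightarrow> S \<subseteq> C" "W S \<noteq> 0 \<Longrightarrow> Q S"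
    "x \<in> C \<Longrightarrow> joint_weight W C x x = 1"
    "x \<in> C \<Longrightarrow> y \<in> C \<Longrightarrow> joint_weight W C x y \<ge> 1 - e x y"
  using assms by (auto simp: stochastic_cover_def)

lemma stochastic_cover_mono:
  assumes "stochastic_cover C Q e W"
    and "\<And>S. S \<subseteq> C \<Longrightarrow> Q S \<Longrightarrow> Q' S"
    and "\<And>x y. x \<in> C \<Longrightarrow> y \<in> C \<Longrightarrow> e x y \<le> e' x y"
  shows "stochastic_cover C Q' e' W"
  unfolding stochastic_cover_def
proof (intro conjI allI ballI impI)
  fix x y assume "x \<in> C" "y \<in> C"
  then show "1 - e' x y \<le> joint_weight W C x y"
    using stochastic_coverD(5)[OF assms(1)] assms(3) by (smt (verit))
next
  fix S assume "W S \<noteq> 0"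
  then show "S \<subseteq> C" "Q' S"
    using stochastic_coverD(2,3)[OF assms(1)] assms(2) by auto
qed (simp_all add: stochastic_coverD[OF assms(1)])

lemma joint_weight_le_1:
  assumes "finite C" "stochastic_cover C Q e W" "x \<in> C"
  shows "joint_weight W C x y \<le> 1"
proof -
  have "joint_weight W C x y \<le> joint_weight W C x x"
    unfolding joint_weight_def
    by (intro sum_mono mult_left_mono) (auto simp: stochastic_coverD(1)[OF assms(2)])
  then show ?thesis
    using stochastic_coverD(4)[OF assms(2,3)] by simp
qed

lemma trivial_stochastic_cover:
  assumes "finite C" "Q C" "\<And>x y. x \<in> C \<Longrightarrow> y \<in> C \<Longrightarrow> e x y \<ge> 0"
  shows "stochastic_cover C Q e (\<lambda>S. of_bool (S = C))"
proof -
  have "joint_weight (\<lambda>S. of_bool (S = C)) C x y = 1" if "x \<in> C" "y \<in> C" for x y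
  proof -
    have "joint_weight (\<lambda>S. of_bool (S = C)) C x y = (\<Sum>S\<in>Pow C. if S = C then 1 else 0)"
      unfolding joint_weight_def using that by (intro sum.cong) auto
    then show ?thesis
      using assms(1) by (simp add: sum.delta)
  qed
  then show ?thesis
    using assms by (auto simp: stochastic_cover_def)
qed

text \<open>Joint weights are linear in the weight, so defects average too. This serves to average
  over random sign matrices.\<close>

lemma stochastic_cover_average:
  assumes "finite G" "G \<noteq> {}" "\<And>g. g \<in> G \<Longrightarrow> stochastic_cover C Q (e g) (W g)"
  shows "stochastic_cover C Q (\<lambda>x y. (\<Sum>g\<in>G. e g x y) / card G) (\<lambda>S. (\<Sum>g\<in>G. W g S) / card G)"
proof -
  have G: "real (card G) > 0"
    using assms by (simp add: card_gt_0_iff)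
  have jw: "joint_weight (\<lambda>S. (\<Sum>g\<in>G. W g S) / card G) C x y = (\<Sum>g\<in>G. joint_weight (W g) C x y) / card G"
    for x y
    unfolding joint_weight_def sum_divide_distrib sum_distrib_right
    by (subst sum.swap) simp
  note D = stochastic_coverD[OF assms(3)]
  show ?thesis
    unfolding stochastic_cover_def jw
  proof (intro conjI allI ballI impI)
    show "0 \<le> (\<Sum>g\<in>G. W g S) / card G" for S
      using D(1) by (intro divide_nonneg_nonneg sum_nonneg) auto
    fix S assume "(\<Sum>g\<in>G. W g S) / card G \<noteq> 0"
    then obtain g where "g \<in> G" "W g S \<noteq> 0"
      by (metis div_0 sum.neutral)
    then show "S \<subseteq> C" "Q S" using D(2,3) by blast+
  next
    fix x assume "x \<in> C"
    then show "(\<Sum>g\<in>G. joint_weight (W g) C x x) / card G = 1"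
      using D(4) G by simp
  next
    fix x y assume "x \<in> C" "y \<in> C"
    then have "(\<Sum>g\<in>G. 1 - e g x y) \<le> (\<Sum>g\<in>G. joint_weight (W g) C x y)"
      using D(5) by (intro sum_mono) auto
    then show "1 - (\<Sum>g\<in>G. e g x y) / card G \<le> (\<Sum>g\<in>G. joint_weight (W g) C x y) / card G"
      using G by (simp add: sum_subtractf pos_le_divide_eq left_diff_distrib)
  qed
qed

text \<open>Take \<open>K\<close> first, then a piece of \<open>K\<close>. A joint weight J of
  \<open>W\<close> satisfies 1 - e1 \<le> J \<le> 1, hence J (1 - e2) \<ge> 1 - e1 - e2: defects add
  with no multiplicative loss.\<close>

lemma stochastic_cover_refine:
  assumes "finite C" "stochastic_cover C Q1 e1 W"
    and V: "\<And>K. K \<subseteq> C \<Longrightarrow> Q1 K \<Longrightarrow> stochastic_cover K Q2 e2 (V K)"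
    and e2: "\<And>x y. x \<in> C \<Longrightarrow> y \<in> C \<Longrightarrow> e2 x y \<ge> 0"
  shows "stochastic_cover C Q2 (\<lambda>x y. e1 x y + e2 x y) (\<lambda>S. \<Sum>K\<in>Pow C. W K * V K S)"
proof -
  note D = stochastic_coverD[OF assms(2)]
  have V': "stochastic_cover K Q2 e2 (V K)" if "W K \<noteq> 0" for K
    using D(2,3)[OF that] V by blast
  note DV = stochastic_coverD[OF V']
  \<comment> \<open>\<open>V K\<close> lives on subsets of \<open>K\<close>, so the sum over subsets
    of \<open>C\<close> collapses to the joint weight inside \<open>K\<close>. Where
    \<open>W K = 0\<close> nothing is known about \<open>V K\<close>, but the term vanishes.\<close>
  have inner: "W K * (\<Sum>S\<in>Pow C. V K S * of_bool (x \<in> S \<and> y \<in> S)) =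
      W K * of_bool (x \<in> K \<and> y \<in> K) * joint_weight (V K) K x y" if K: "K \<in> Pow C" for K x y
  proof (cases "W K = 0")
    case False
    have sub: "S \<subseteq> K" if "V K S \<noteq> 0" for S
      using DV(2)[OF False that] .
    have "(\<Sum>S\<in>Pow C. V K S * of_bool (x \<in> S \<and> y \<in> S)) =
        (\<Sum>S\<in>Pow K. V K S * of_bool (x \<in> S \<and> y \<in> S))"
      using K assms(1) sub by (intro sum.mono_neutral_right) auto
    moreover have "joint_weight (V K) K x y = 0" if "\<not> (x \<in> K \<and> y \<in> K)"
      using that unfolding joint_weight_def by (intro sum.neutral) auto
    ultimately show ?thesis
      unfolding joint_weight_def by (cases "x \<in> K \<and> y \<in> K") auto
  qed simp
  have jw: "joint_weight (\<lambda>S. \<Sum>K\<in>Pow C. W K * V K S) C x y =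
      (\<Sum>K\<in>Pow C. W K * of_bool (x \<in> K \<and> y \<in> K) * joint_weight (V K) K x y)" for x y
  proof -
    have "joint_weight (\<lambda>S. \<Sum>K\<in>Pow C. W K * V K S) C x y =
        (\<Sum>K\<in>Pow C. W K * (\<Sum>S\<in>Pow C. V K S * of_bool (x \<in> S \<and> y \<in> S)))"
      unfolding joint_weight_def sum_distrib_right sum_distrib_left
      by (subst sum.swap) (simp add: mult.assoc)
    then show ?thesis using inner by simp
  qed
  show ?thesis
    unfolding stochastic_cover_def jw
  proof (intro conjI allI ballI impI)
    show "0 \<le> (\<Sum>K\<in>Pow C. W K * V K S)" for S
    proof (intro sum_nonneg)
      show "0 \<le> W K * V K S" for K
        using DV(1)[of K] D(1)[of K] by (cases "W K = 0") auto
    qed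
    fix S assume "(\<Sum>K\<in>Pow C. W K * V K S) \<noteq> 0"
    then obtain K where "W K * V K S \<noteq> 0" "K \<subseteq> C"
      by (metis (no_types, lifting) PowD sum.neutral)
    then show "S \<subseteq> C" "Q2 S" using DV(2,3)[of K S] by auto
  next
    fix x assume x: "x \<in> C"
    have "W K * of_bool (x \<in> K \<and> x \<in> K) * joint_weight (V K) K x x = W K * of_bool (x \<in> K \<and> x \<in> K)" for K
      using DV(4)[of K x] by (cases "W K = 0 \<or> x \<notin> K") auto
    then show "(\<Sum>K\<in>Pow C. W K * of_bool (x \<in> K \<and> x \<in> K) * joint_weight (V K) K x x) = 1"
      using D(4)[OF x] unfolding joint_weight_def[of W] by (simp only:)
  next
    fix x y assume xy: "x \<in> C" "y \<in> C"
    have "W K * of_bool (x \<in> K \<and> y \<in> K) * (1 - e2 x y) \<le>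
        W K * of_bool (x \<in> K \<and> y \<in> K) * joint_weight (V K) K x y" for K
      using DV(5)[of K x y] D(1)[of K] by (cases "W K = 0 \<or> \<not> (x \<in> K \<and> y \<in> K)") (auto intro: mult_left_mono)
    then have "joint_weight W C x y * (1 - e2 x y) \<le>
        (\<Sum>K\<in>Pow C. W K * of_bool (x \<in> K \<and> y \<in> K) * joint_weight (V K) K x y)"
      unfolding joint_weight_def sum_distrib_right by (intro sum_mono)
    moreover have "joint_weight W C x y * e2 x y \<le> 1 * e2 x y"
      using joint_weight_le_1[OF assms(1,2) xy(1)] e2[OF xy] by (intro mult_right_mono)
    ultimately show "1 - (e1 x y + e2 x y) \<le>
        (\<Sum>K\<in>Pow C. W K * of_bool (x \<in> K \<and> y \<in> K) * joint_weight (V K) K x y)"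
      using D(5)[OF xy] by (simp add: right_diff_distrib)
  qed
qed

text \<open>Layer-cake decomposition: \<open>g\<close> is a positive combination of indicators of
  its superlevel sets, and a level lies below both values exactly when it lies below their minimum.
  Layers are removed from the bottom, by induction on the number of points where \<open>g\<close> is
  positive.\<close>

lemma layer_cake_weights:
  fixes g :: "'a \<Rightarrow> real"
  assumes "finite C" "\<And>x. x \<in> C \<Longrightarrow> g x \<ge> 0"
  shows "\<exists>w. (\<forall>S. w S \<ge> 0) \<and> (\<forall>S. w S \<noteq> 0 \<longrightarrow> S \<subseteq> {x\<in>C. g x > 0}) \<and>
           (\<forall>x\<in>C. \<forall>y\<in>C. joint_weight w C x y = min (g x) (g y))"
  using assms(2)
proof (induction "card {x\<in>C. g x > 0}" arbitrary: g rule: less_induct)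
  case less
  define S0 where "S0 = {x\<in>C. g x > 0}"
  show ?case
  proof (cases "S0 = {}")
    case True
    then have "g x = 0" if "x \<in> C" for x
      using that less.prems[OF that] by (force simp: S0_def)
    then show ?thesis
      by (intro exI[of _ "\<lambda>_. 0"]) (auto simp: joint_weight_def)
  next
    case False
    have fin: "finite S0" using assms(1) by (simp add: S0_def)
    define m where "m = Min (g ` S0)"
    have m: "m \<in> g ` S0" "\<And>x. x \<in> S0 \<Longrightarrow> m \<le> g x"
      using fin False by (auto simp: m_def)
    then have m0: "m > 0" by (auto simp: S0_def)
    \<comment> \<open>Removing a layer of height \<open>m\<close> sends the minimisers in
      \<open>S0\<close> to 0, so the positive set shrinks.\<close>
    define g' where "g' = (\<lambda>x. g x - m * of_bool (x \<in> S0))"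
    have g'0: "g' x \<ge> 0" if "x \<in> C" for x
      using less.prems[OF that] m(2) by (auto simp: g'_def)
    have sub: "{x\<in>C. g' x > 0} \<subseteq> S0"
      by (auto simp: g'_def S0_def split: if_splits)
    moreover obtain x0 where "x0 \<in> S0" "g x0 = m" using m(1) by auto
    then have "x0 \<notin> {x\<in>C. g' x > 0}" by (auto simp: g'_def)
    ultimately have "card {x\<in>C. g' x > 0} < card S0"
      using fin \<open>x0 \<in> S0\<close> by (intro psubset_card_mono) auto
    then have "\<exists>w. (\<forall>S. w S \<ge> 0) \<and> (\<forall>S. w S \<noteq> 0 \<longrightarrow> S \<subseteq> {x\<in>C. g' x > 0}) \<and>
        (\<forall>x\<in>C. \<forall>y\<in>C. joint_weight w C x y = min (g' x) (g' y))"
      unfolding S0_def by (rule less.hyps) (rule g'0)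
    then obtain w where w: "(\<forall>S. w S \<ge> 0) \<and> (\<forall>S. w S \<noteq> 0 \<longrightarrow> S \<subseteq> {x\<in>C. g' x > 0}) \<and>
        (\<forall>x\<in>C. \<forall>y\<in>C. joint_weight w C x y = min (g' x) (g' y))"
      by (rule exE)
    define w' where "w' = (\<lambda>S. w S + m * of_bool (S = S0))"
    have "joint_weight w' C x y = min (g x) (g y)" if xy: "x \<in> C" "y \<in> C" for x y
    proof -
      have "S0 \<in> Pow C" by (auto simp: S0_def)
      then have *: "(\<Sum>S\<in>Pow C. if S = S0 then m * of_bool (x \<in> S0 \<and> y \<in> S0) else 0) =
          m * of_bool (x \<in> S0 \<and> y \<in> S0)"
        using assms(1) by (subst sum.delta) auto
      have "joint_weight w' C x y = joint_weight w C x y +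
          (\<Sum>S\<in>Pow C. if S = S0 then m * of_bool (x \<in> S0 \<and> y \<in> S0) else 0)"
        unfolding joint_weight_def w'_def sum.distrib[symmetric]
        by (intro sum.cong) (auto simp: distrib_right)
      then have "joint_weight w' C x y = joint_weight w C x y + m * of_bool (x \<in> S0 \<and> y \<in> S0)"
        using * by simp
      also have "\<dots> = min (g x) (g y)"
        using w[THEN conjunct2, THEN conjunct2, rule_format, OF xy] less.prems[OF xy(1)] less.prems[OF xy(2)] m(2) xy
        by (force simp: g'_def S0_def min_def not_less split: if_splits)
      finally show ?thesis .
    qed
    moreover have "w' S \<ge> 0" for S
      using w[THEN conjunct1, rule_format, of S] m0 by (simp add: w'_def)
    moreover have "S \<subseteq> {x\<in>C. g x > 0}" if "w' S \<noteq> 0" for S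
    proof (cases "S = S0")
      case False
      with that have "w S \<noteq> 0" by (simp add: w'_def)
      then have "S \<subseteq> {x\<in>C. g' x > 0}" using w by metis
      then show ?thesis using sub unfolding S0_def by (rule subset_trans)
    qed (simp add: S0_def)
    ultimately show ?thesis
      by (intro exI[of _ w'] conjI allI impI ballI)
  qed
qed

section \<open>From stochastic covers to random partitions\<close>

lemma pmf_of_weights:
  assumes "finite F" "\<And>x. x \<in> F \<Longrightarrow> f x \<ge> 0" "sum f F = 1"
  shows "\<exists>p. \<forall>x. pmf p x = (if x \<in> F then f x else 0)"
proof -
  let ?f = "\<lambda>x. if x \<in> F then f x else 0"
  have "(\<integral>\<^sup>+x. ennreal (?f x) \<partial>count_space UNIV) = (\<Sum>x\<in>F. ennreal (?f x))"
    using assms(1) by (intro nn_integral_count_space'[of F]) auto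
  also have "\<dots> = ennreal (\<Sum>x\<in>F. f x)"
    using assms(2) by (subst sum_ennreal[symmetric]) auto
  finally have "(\<integral>\<^sup>+x. ennreal (?f x) \<partial>count_space UNIV) = 1"
    using assms(3) by simp
  then have "pmf (embed_pmf ?f) x = ?f x" for x
    using assms(2) by (intro pmf_embed_pmf) auto
  then show ?thesis by blast
qed

text \<open>Random carving: draw \<open>S\<close> with probability proportional to \<open>W\<close>,
  keep \<open>S \<inter> A\<close> as a cluster and recurse on \<open>A - S\<close>. With J the
  joint weight of x and y, the sets meeting {x, y} weigh 2 - J \<ge> 1 in total, and those
  containing exactly one of the two weigh 2 - 2 J; hence the bound 2 (1 - J).\<close>

lemma random_partition_of_stochastic_cover:
  assumes "finite C" and W: "stochastic_cover C Q e W" and "A \<subseteq> C"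
  shows "\<exists>D. (\<forall>P\<in>set_pmf D. partition_on A P \<and> (\<forall>K\<in>P. \<exists>S. W S \<noteq> 0 \<and> K \<subseteq> S)) \<and>
           (\<forall>x\<in>A. \<forall>y\<in>A. measure_pmf.prob D {P. \<not> (\<exists>K\<in>P. x \<in> K \<and> y \<in> K)}
              \<le> 2 * (1 - joint_weight W C x y))"
  using assms(3)
proof (induction "card A" arbitrary: A rule: less_induct)
  case less
  note D = stochastic_coverD[OF W]
  define sep where "sep = (\<lambda>x y. {P. \<not> (\<exists>K\<in>P. x \<in> K \<and> y \<in> K)} :: 'a set set set)"
  have finA: "finite A" using less.prems assms(1) finite_subset by blast
  show ?case
  proof (cases "A = {}")
    case True
    then show ?thesis by (intro exI[of _ "return_pmf {}"]) (simp add: partition_on_empty)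
  next
    case False
    \<comment> \<open>Only sets that meet \<open>A\<close> are drawn, so every round removes a point
      and the recursion ends.\<close>
    define F where "F = {S\<in>Pow C. S \<inter> A \<noteq> {}}"
    define T where "T = sum W F"
    have finF: "finite F" using assms(1) by (simp add: F_def)
    have sum_F: "(\<Sum>S\<in>F. W S * of_bool (x \<in> S \<and> y \<in> S)) = joint_weight W C x y" if "x \<in> A" for x y
      unfolding joint_weight_def F_def using that assms(1)
      by (intro sum.mono_neutral_left) auto
    obtain a where a: "a \<in> A" using False by blast
    have "1 = (\<Sum>S\<in>F. W S * of_bool (a \<in> S \<and> a \<in> S))"
      using sum_F[OF a, of a] D(4)[of a] a less.prems by (simp add: subset_iff)
    also have "\<dots> \<le> T"
      unfolding T_def using D(1) by (intro sum_mono) (simp add: of_bool_def)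
    finally have T: "T \<ge> 1" .
    have "(\<Sum>S\<in>F. W S / T) = 1"
      using T by (simp add: T_def flip: sum_divide_distrib)
    with pmf_of_weights[OF finF, of "\<lambda>S. W S / T"] D(1) T
    obtain p where p: "\<And>S. pmf p S = (if S \<in> F then W S / T else 0)" by fastforce
    have supp: "S \<in> F" "W S \<noteq> 0" if "S \<in> set_pmf p" for S
      using that p[of S] by (auto simp: set_pmf_eq split: if_splits)
    have "\<exists>D. (\<forall>P\<in>set_pmf D. partition_on (A - S) P \<and> (\<forall>K\<in>P. \<exists>S. W S \<noteq> 0 \<and> K \<subseteq> S)) \<and>
           (\<forall>x\<in>A - S. \<forall>y\<in>A - S. measure_pmf.prob D {P. \<not> (\<exists>K\<in>P. x \<in> K \<and> y \<in> K)}
              \<le> 2 * (1 - joint_weight W C x y))" if "S \<in> F" for S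
    proof (rule less.hyps)
      show "card (A - S) < card A"
        using that finA by (intro psubset_card_mono) (auto simp: F_def)
    qed (use less.prems in auto)
    then have "\<forall>S\<in>F. \<exists>D. (\<forall>P\<in>set_pmf D. partition_on (A - S) P \<and> (\<forall>K\<in>P. \<exists>S. W S \<noteq> 0 \<and> K \<subseteq> S)) \<and>
           (\<forall>x\<in>A - S. \<forall>y\<in>A - S. measure_pmf.prob D (sep x y) \<le> 2 * (1 - joint_weight W C x y))"
      unfolding sep_def by (rule ballI)
    from bchoice[OF this] obtain D' where D':
      "\<forall>S\<in>F. (\<forall>P\<in>set_pmf (D' S). partition_on (A - S) P \<and> (\<forall>K\<in>P. \<exists>S. W S \<noteq> 0 \<and> K \<subseteq> S)) \<and>
           (\<forall>x\<in>A - S. \<forall>y\<in>A - S. measure_pmf.prob (D' S) (sep x y) \<le> 2 * (1 - joint_weight W C x y))"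
      by (rule exE)
    note D' = bspec[OF D']
    define R where "R = (\<lambda>S. map_pmf (insert (S \<inter> A)) (D' S))"
    have "partition_on A P \<and> (\<forall>K\<in>P. \<exists>S. W S \<noteq> 0 \<and> K \<subseteq> S)" if P: "P \<in> set_pmf (bind_pmf p R)" for P
    proof -
      obtain S P' where S: "S \<in> set_pmf p" and P': "P' \<in> set_pmf (D' S)" "P = insert (S \<inter> A) P'"
        using P unfolding R_def set_bind_pmf set_map_pmf by blast
      note supp = supp[OF S]
      have p': "partition_on (A - S) P'" "\<forall>K\<in>P'. \<exists>S. W S \<noteq> 0 \<and> K \<subseteq> S"
        using D'[OF supp(1), THEN conjunct1, rule_format, OF P'(1)] by simp_all
      have "disjnt (S \<inter> A) (\<Union>P')"
        using partition_onD1[OF p'(1)] by (auto simp: disjnt_def)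
      moreover have "A - S \<inter> A = A - S" by blast
      ultimately have "partition_on A P"
        using p'(1) supp(1) by (simp add: P'(2) partition_on_insert F_def)
      then show ?thesis using p'(2) supp(2) P'(2) by auto
    qed
    moreover have "measure_pmf.prob (bind_pmf p R) (sep x y) \<le> 2 * (1 - joint_weight W C x y)"
      if xy: "x \<in> A" "y \<in> A" for x y
    proof -
      define J where "J = joint_weight W C x y"
      have J: "J \<le> 1"
        unfolding J_def using joint_weight_le_1[OF assms(1) W] xy less.prems by auto
      have finR: "finite (set_pmf (R S))" if "S \<in> set_pmf p" for S
      proof -
        have "set_pmf (D' S) \<subseteq> {P. partition_on (A - S) P}"
          using D'[OF supp(1)[OF that], THEN conjunct1] by blast
        then show ?thesis
          using finitely_many_partition_on[of "A - S"] finA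
          by (auto simp: R_def intro: finite_subset)
      qed
      have subp: "set_pmf p \<subseteq> F" using supp(1) by (rule subsetI)
      then have finp: "finite (set_pmf p)" using finF by (rule finite_subset)
      \<comment> \<open>Three cases, encoded by inclusion-exclusion on indicators: \<open>S\<close>
        contains both points and does not separate them; it contains exactly one, and the
        probability is at most 1; or it contains neither, and the recursive bound
        \<open>2 * (1 - J)\<close> applies.\<close>
      have bound: "W S * measure_pmf.prob (R S) (sep x y) \<le>
          W S * of_bool (x \<in> S \<and> x \<in> S) + W S * of_bool (y \<in> S \<and> y \<in> S) - 2 * (W S * of_bool (x \<in> S \<and> y \<in> S)) +
          (2 * (1 - J)) * (W S - W S * of_bool (x \<in> S \<and> x \<in> S) - W S * of_bool (y \<in> S \<and> y \<in> S) + W S * of_bool (x \<in> S \<and> y \<in> S))"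
        if "S \<in> F" for S
      proof -
        consider "x \<in> S \<and> y \<in> S" | "x \<in> S \<longleftrightarrow> y \<notin> S" | "x \<notin> S \<and> y \<notin> S" by blast
        then show ?thesis
        proof cases
          case 1
          then have "insert (S \<inter> A) -` sep x y = {}"
            using xy by (auto simp: sep_def)
          then show ?thesis using 1 by (simp add: R_def)
        next
          case 2
          then show ?thesis using D(1)[of S] by (auto intro: mult_left_le)
        next
          case 3
          have "measure_pmf.prob (R S) (sep x y) = measure_pmf.prob (D' S) (insert (S \<inter> A) -` sep x y)"
            by (simp add: R_def)
          also have "\<dots> \<le> measure_pmf.prob (D' S) (sep x y)"
            by (intro measure_pmf.finite_measure_mono) (auto simp: sep_def)
          also have "\<dots> \<le> 2 * (1 - J)"
            using D'[OF \<open>S \<in> F\<close>, THEN conjunct2] xy 3 by (simp add: J_def)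
          finally show ?thesis
            using 3 D(1)[of S] by (simp add: mult_left_mono mult.commute)
        qed
      qed
      have "measure_pmf.prob (bind_pmf p R) (sep x y) =
          measure_pmf.expectation (bind_pmf p R) (indicator (sep x y))"
        by simp
      also have "\<dots> = (\<Sum>S\<in>set_pmf p. pmf p S * measure_pmf.prob (R S) (sep x y))"
        by (subst pmf_expectation_bind[OF finp finR]) simp_all
      also have "\<dots> = (\<Sum>S\<in>F. pmf p S * measure_pmf.prob (R S) (sep x y))"
        using finF subp by (intro sum.mono_neutral_left) (auto simp: set_pmf_eq)
      also have "\<dots> = (\<Sum>S\<in>F. W S * measure_pmf.prob (R S) (sep x y)) / T"
        by (simp add: p sum_divide_distrib)
      also have "\<dots> \<le> (\<Sum>S\<in>F. W S * of_bool (x \<in> S \<and> x \<in> S) + W S * of_bool (y \<in> S \<and> y \<in> S) - 2 * (W S * of_bool (x \<in> S \<and> y \<in> S)) +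
          (2 * (1 - J)) * (W S - W S * of_bool (x \<in> S \<and> x \<in> S) - W S * of_bool (y \<in> S \<and> y \<in> S) + W S * of_bool (x \<in> S \<and> y \<in> S))) / T"
        using T bound by (intro divide_right_mono sum_mono) auto
      also have "\<dots> = (1 + 1 - 2 * J + (2 * (1 - J)) * (T - 1 - 1 + J)) / T"
        unfolding sum.distrib sum_subtractf sum_distrib_left[symmetric] sum_F[OF xy(1)] sum_F[OF xy(2)]
          J_def[symmetric] T_def[symmetric]
        using D(4)[of x] D(4)[of y] xy less.prems by (simp add: subset_iff)
      \<comment> \<open>Since \<open>J \<le> 1\<close>, T - 2 + J is at most T - 1; then
        \<open>T\<close> cancels and the bound reproduces itself.\<close>
      also have "\<dots> \<le> (2 * (1 - J) + (2 * (1 - J)) * (T - 1)) / T"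
        using T J by (intro divide_right_mono add_mono mult_left_mono) auto
      also have "\<dots> = 2 * (1 - J)"
        using T by (simp add: field_simps)
      finally show ?thesis by (simp add: J_def)
    qed
    ultimately show ?thesis unfolding sep_def by blast
  qed
qed

text \<open>Clusters inherit the diameter bound as subsets of sets of nonzero weight. The factor 2
  lost in carving sits in the relation between \<open>L\<close> and \<open>\<beta>\<close>.\<close>

lemma lipschitz_decomposition_of_stochastic_cover:
  assumes "finite C"
    and W: "stochastic_cover C (\<lambda>S. \<forall>x\<in>S. \<forall>y\<in>S. dst x y \<le> \<Delta>) (\<lambda>x y. L * dst x y) W"
    and \<beta>: "2 * L = \<beta> / \<Delta>"
  shows "\<exists>D. lipschitz_decomposition dst C \<beta> \<Delta> D"
proof -
  note D = stochastic_coverD[OF W]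
  obtain D where *: "(\<forall>P\<in>set_pmf D. partition_on C P \<and> (\<forall>K\<in>P. \<exists>S. W S \<noteq> 0 \<and> K \<subseteq> S)) \<and>
      (\<forall>x\<in>C. \<forall>y\<in>C. measure_pmf.prob D {P. \<not> (\<exists>K\<in>P. x \<in> K \<and> y \<in> K)}
              \<le> 2 * (1 - joint_weight W C x y))"
    using random_partition_of_stochastic_cover[OF assms(1) W order_refl] by (rule exE)
  have D': "partition_on C P" "\<forall>K\<in>P. \<exists>S. W S \<noteq> 0 \<and> K \<subseteq> S" if "P \<in> set_pmf D" for P
    using *[THEN conjunct1, THEN bspec, OF that] by simp_all
  have sep: "measure_pmf.prob D {P. \<not> (\<exists>K\<in>P. x \<in> K \<and> y \<in> K)} \<le> 2 * (1 - joint_weight W C x y)"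
    if "x \<in> C" "y \<in> C" for x y
    using *[THEN conjunct2, THEN bspec, THEN bspec, OF that] .
  have "set_diam dst K \<le> \<Delta>" if PK: "P \<in> set_pmf D" "K \<in> P" for P K
  proof -
    obtain S where "W S \<noteq> 0" "K \<subseteq> S" using D'(2)[OF PK(1)] PK(2) by auto
    moreover have "K \<noteq> {}" using partition_onD3[OF D'(1)[OF PK(1)]] PK(2) by auto
    ultimately show ?thesis
      using D(3)[of S] unfolding set_diam_def by (intro cSUP_least) (auto simp: subset_iff)
  qed
  moreover have "measure_pmf.prob D {P. cluster P x \<noteq> cluster P y} \<le> \<beta> * dst x y / \<Delta>"
    if xy: "x \<in> C" "y \<in> C" for x y
  proof -
    have cl: "cluster P z = K" if "P \<in> set_pmf D" "K \<in> P" "z \<in> K" for P K z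
      unfolding cluster_def
    proof (rule the_equality)
      show "A = K" if "A \<in> P \<and> z \<in> A" for A
        using partition_onD2[OF D'(1)] \<open>P \<in> set_pmf D\<close> \<open>K \<in> P\<close> \<open>z \<in> K\<close> that
        by (auto dest: disjointD)
    qed (use that in auto)
    \<comment> \<open>Off the support, the description in \<open>cluster\<close> need not denote a
      block containing the point, so the event is first cut down to the support.\<close>
    have "measure_pmf.prob D {P. cluster P x \<noteq> cluster P y} =
        measure_pmf.prob D ({P. cluster P x \<noteq> cluster P y} \<inter> set_pmf D)"
      by (simp add: measure_Int_set_pmf)
    also have "\<dots> \<le> measure_pmf.prob D {P. \<not> (\<exists>K\<in>P. x \<in> K \<and> y \<in> K)}"
      using cl by (intro measure_pmf.finite_measure_mono) auto
    also have "\<dots> \<le> 2 * (1 - joint_weight W C x y)" using sep[OF xy] .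
    also have "\<dots> \<le> (2 * L) * dst x y" using D(5)[OF xy] by simp
    also have "\<dots> = \<beta> * dst x y / \<Delta>" unfolding \<beta> by simp
    finally show ?thesis .
  qed
  ultimately show ?thesis
    using D'(1) unfolding lipschitz_decomposition_def by (intro exI[of _ D]) simp
qed

section \<open>Rounding to the integer lattice\<close>

text \<open>An amplitude, whose square is the weight: at distances t and 1 - t the squares are cos^2
  and sin^2 of the same angle. With amplitudes, 1 minus the affinity is quadratic in the
  distance.\<close>

definition bump :: "real \<Rightarrow> real" where
  "bump u = cos (pi / 2 * min 1 \<bar>u\<bar>)"

lemma bump_nonneg: "bump u \<ge> 0"
proof -
  have "0 \<le> pi / 2 * min 1 \<bar>u\<bar>" "pi / 2 * min 1 \<bar>u\<bar> \<le> pi / 2"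
    by (simp_all add: mult_left_le)
  then show ?thesis unfolding bump_def by (intro cos_ge_zero) linarith+
qed

lemma bump_eq_0: "\<bar>u\<bar> \<ge> 1 \<Longrightarrow> bump u = 0"
  by (simp add: bump_def min_def)

lemma abs_cos_diff_le: "\<bar>cos x - cos y\<bar> \<le> \<bar>x - y\<bar>" for x y :: real
proof -
  have "cos x - cos y = 2 * sin ((x + y) / 2) * sin ((y - x) / 2)"
    by (rule cos_diff_cos)
  then have "\<bar>cos x - cos y\<bar> = 2 * (\<bar>sin ((x + y) / 2)\<bar> * \<bar>sin ((y - x) / 2)\<bar>)"
    by (simp add: abs_mult)
  also have "\<dots> \<le> 2 * (1 * \<bar>(y - x) / 2\<bar>)"
    by (intro mult_left_mono mult_mono abs_sin_x_le_abs_x) auto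
  finally show ?thesis by simp
qed

lemma bump_diff_le: "\<bar>bump u - bump v\<bar> \<le> 2 * \<bar>u - v\<bar>"
proof -
  have "\<bar>bump u - bump v\<bar> \<le> \<bar>pi / 2 * (min 1 \<bar>u\<bar> - min 1 \<bar>v\<bar>)\<bar>"
    unfolding bump_def using abs_cos_diff_le[of "pi / 2 * min 1 \<bar>u\<bar>" "pi / 2 * min 1 \<bar>v\<bar>"]
    by (simp add: right_diff_distrib)
  also have "\<dots> = pi / 2 * \<bar>min 1 \<bar>u\<bar> - min 1 \<bar>v\<bar>\<bar>"
    by (simp add: abs_mult)
  also have "\<dots> \<le> 2 * \<bar>u - v\<bar>"
    using pi_less_4 by (intro mult_mono) auto
  finally show ?thesis .
qed

lemma bump_support:
  assumes "bump (x - real_of_int z) \<noteq> 0"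
  shows "z = \<lfloor>x\<rfloor> \<or> z = \<lfloor>x\<rfloor> + 1"
proof -
  have "\<bar>x - real_of_int z\<bar> < 1"
    using assms bump_eq_0 by (meson not_less)
  then show ?thesis by linarith
qed

lemma sum_bump_sq:
  assumes "finite Z" "{\<lfloor>x\<rfloor>, \<lfloor>x\<rfloor> + 1} \<subseteq> Z"
  shows "(\<Sum>z\<in>Z. (bump (x - real_of_int z))\<^sup>2) = 1"
proof -
  define t where "t = frac x"
  have t: "0 \<le> t" "t < 1" by (auto simp: t_def frac_lt_1)
  have "(\<Sum>z\<in>Z. (bump (x - real_of_int z))\<^sup>2) = (\<Sum>z\<in>{\<lfloor>x\<rfloor>, \<lfloor>x\<rfloor> + 1}. (bump (x - real_of_int z))\<^sup>2)"
    using assms bump_support by (intro sum.mono_neutral_right) auto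
  also have "\<dots> = (bump t)\<^sup>2 + (bump (t - 1))\<^sup>2"
    by (simp add: t_def frac_def algebra_simps)
  also have "\<dots> = (cos (pi / 2 * t))\<^sup>2 + (cos (pi / 2 - pi / 2 * t))\<^sup>2"
  proof -
    have "min 1 \<bar>t\<bar> = t" "min 1 \<bar>t - 1\<bar> = 1 - t" using t by auto
    then show ?thesis unfolding bump_def by (simp add: right_diff_distrib)
  qed
  also have "\<dots> = 1"
    unfolding cos_diff by simp
  finally show ?thesis .
qed

text \<open>For unit vectors the squared distance is twice 1 minus the inner product. At most four
  integers contribute, each at most (2 |x - y|)^2, so the constant is 4 * 4 / 2 = 8. The quadratic
  bound is what later yields a Euclidean distance when coordinates are summed.\<close>

lemma sum_bump_prod:
  assumes "finite Z" "{\<lfloor>x\<rfloor>, \<lfloor>x\<rfloor> + 1} \<subseteq> Z" "{\<lfloor>y\<rfloor>, \<lfloor>y\<rfloor> + 1} \<subseteq> Z"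
  shows "1 - (\<Sum>z\<in>Z. bump (x - real_of_int z) * bump (y - real_of_int z)) \<in> {0..8 * (x - y)\<^sup>2}"
proof -
  let ?f = "\<lambda>z. bump (x - real_of_int z)" and ?g = "\<lambda>z. bump (y - real_of_int z)"
  let ?U = "{\<lfloor>x\<rfloor>, \<lfloor>x\<rfloor> + 1, \<lfloor>y\<rfloor>, \<lfloor>y\<rfloor> + 1}"
  have eq: "(\<Sum>z\<in>Z. (?f z - ?g z)\<^sup>2) = 2 * (1 - (\<Sum>z\<in>Z. ?f z * ?g z))"
    using sum_bump_sq[OF assms(1,2)] sum_bump_sq[OF assms(1,3)]
    by (simp add: power2_diff sum.distrib sum_subtractf mult.assoc flip: sum_distrib_left)
  have "(\<Sum>z\<in>Z. (?f z - ?g z)\<^sup>2) = (\<Sum>z\<in>?U. (?f z - ?g z)\<^sup>2)"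
  proof (intro sum.mono_neutral_right ballI)
    fix z assume "z \<in> Z - ?U"
    then have "?f z = 0" "?g z = 0" using bump_support by auto
    then show "(?f z - ?g z)\<^sup>2 = 0" by simp
  qed (use assms in auto)
  also have "\<dots> \<le> real (card ?U) * (2 * \<bar>x - y\<bar>)\<^sup>2"
  proof (rule sum_bounded_above)
    fix z
    have "\<bar>?f z - ?g z\<bar> \<le> 2 * \<bar>x - y\<bar>"
      using bump_diff_le[of "x - real_of_int z" "y - real_of_int z"] by simp
    then show "(?f z - ?g z)\<^sup>2 \<le> (2 * \<bar>x - y\<bar>)\<^sup>2"
      by (metis abs_ge_zero power2_abs power_mono)
  qed
  also have "\<dots> \<le> 4 * (2 * \<bar>x - y\<bar>)\<^sup>2"
  proof (intro mult_right_mono)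
    have "card ?U \<le> 4" by (simp add: card_insert_if)
    then show "real (card ?U) \<le> 4" by simp
  qed simp
  finally have "2 * (1 - (\<Sum>z\<in>Z. ?f z * ?g z)) \<le> 16 * (x - y)\<^sup>2"
    unfolding eq by (simp add: power_mult_distrib)
  moreover have "0 \<le> 2 * (1 - (\<Sum>z\<in>Z. ?f z * ?g z))"
    unfolding eq[symmetric] by (intro sum_nonneg) simp
  ultimately show ?thesis by simp
qed

text \<open>Total variation against Hellinger distance: factor f^2 - g^2 as (f - g) (f + g) and
  apply Cauchy-Schwarz. The overlap is 1 minus half the l_1 distance of the two weights.\<close>

lemma sum_min_ge_of_hellinger:
  fixes f g :: "'b \<Rightarrow> real"
  assumes "\<And>z. z \<in> Z \<Longrightarrow> f z \<ge> 0" "\<And>z. z \<in> Z \<Longrightarrow> g z \<ge> 0"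
    and "(\<Sum>z\<in>Z. (f z)\<^sup>2) = 1" "(\<Sum>z\<in>Z. (g z)\<^sup>2) = 1"
    and A: "1 - (\<Sum>z\<in>Z. f z * g z) \<le> a" and "0 \<le> a"
  shows "(\<Sum>z\<in>Z. min ((f z)\<^sup>2) ((g z)\<^sup>2)) \<ge> 1 - sqrt (2 * a)"
proof -
  have minus: "(\<Sum>z\<in>Z. \<bar>f z - g z\<bar>\<^sup>2) = 2 * (1 - (\<Sum>z\<in>Z. f z * g z))"
    and plus: "(\<Sum>z\<in>Z. (f z + g z)\<^sup>2) = 2 * (1 + (\<Sum>z\<in>Z. f z * g z))"
    using assms(3,4)
    by (simp_all add: power2_diff power2_sum sum.distrib sum_subtractf mult.assoc flip: sum_distrib_left)
  have le1: "(\<Sum>z\<in>Z. f z * g z) \<le> 1"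
    using minus sum_nonneg[of Z "\<lambda>z. \<bar>f z - g z\<bar>\<^sup>2"] by simp
  have abs: "\<bar>(f z)\<^sup>2 - (g z)\<^sup>2\<bar> = \<bar>f z - g z\<bar> * (f z + g z)" if "z \<in> Z" for z
    using assms(1,2)[OF that] by (simp add: power2_eq_square square_diff_square_factored abs_mult)
  have "(\<Sum>z\<in>Z. \<bar>(f z)\<^sup>2 - (g z)\<^sup>2\<bar>)\<^sup>2 \<le> (2 * (1 - (\<Sum>z\<in>Z. f z * g z))) * (2 * (1 + (\<Sum>z\<in>Z. f z * g z)))"
    using Cauchy_Schwarz_ineq_sum[of "\<lambda>z. \<bar>f z - g z\<bar>" "\<lambda>z. f z + g z" Z] minus plus
    by (simp add: abs)
  also have "\<dots> \<le> (2 * a) * (2 * 2)"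
    using A le1 assms(1,2,6) by (intro mult_mono mult_left_mono) (auto intro!: add_nonneg_nonneg sum_nonneg)
  finally have "(\<Sum>z\<in>Z. \<bar>(f z)\<^sup>2 - (g z)\<^sup>2\<bar>) \<le> sqrt (4 * (2 * a))"
    by (intro real_le_rsqrt) simp
  then have "(\<Sum>z\<in>Z. \<bar>(f z)\<^sup>2 - (g z)\<^sup>2\<bar>) \<le> 2 * sqrt (2 * a)"
    unfolding real_sqrt_mult[of 4] by simp
  moreover have "2 * (\<Sum>z\<in>Z. min ((f z)\<^sup>2) ((g z)\<^sup>2)) = 1 + 1 - (\<Sum>z\<in>Z. \<bar>(f z)\<^sup>2 - (g z)\<^sup>2\<bar>)"
  proof -
    have "2 * min u v = u + v - \<bar>u - v\<bar>" for u v :: real by (simp add: min_def)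
    then show ?thesis
      using assms(3,4) by (simp add: sum_distrib_left sum.distrib sum_subtractf)
  qed
  ultimately show ?thesis by simp
qed

text \<open>Each x spreads the weights (f z x)^2 over lattice points z, and for every z a layer cake
  in x gives weighted sets. Points sharing a z are within 1 of it in each coordinate, hence within 2
  of each other. Since 1 minus the affinity is at most 8 times the squared distance, the defect
  constant is sqrt (2 * 8) = 4.\<close>

lemma lattice_cover:
  fixes T :: "'a \<Rightarrow> nat \<Rightarrow> real"
  assumes "finite C"
  shows "\<exists>W. stochastic_cover C (\<lambda>S. \<forall>x\<in>S. \<forall>y\<in>S. \<forall>i<k. \<bar>T x i - T y i\<bar> \<le> 2)
           (\<lambda>x y. 4 * sqrt (\<Sum>i<k. (T x i - T y i)\<^sup>2)) W"
proof -
  \<comment> \<open>One finite set of integers serves all points and coordinates, so the lattice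
    points form a full product and sums of products factor.\<close>
  define Z1 where "Z1 = (\<Union>x\<in>C. \<Union>i<k. {\<lfloor>T x i\<rfloor>, \<lfloor>T x i\<rfloor> + 1})"
  have finZ1: "finite Z1" using assms by (simp add: Z1_def)
  have subZ1: "{\<lfloor>T x i\<rfloor>, \<lfloor>T x i\<rfloor> + 1} \<subseteq> Z1" if "x \<in> C" "i < k" for x i
    using that by (auto simp: Z1_def)
  define Z where "Z = PiE {..<k} (\<lambda>_. Z1)"
  have finZ: "finite Z" unfolding Z_def using finZ1 by (intro finite_PiE) auto
  define f where "f = (\<lambda>z x. \<Prod>i<k. bump (T x i - real_of_int (z i)))"
  have f0: "f z x \<ge> 0" for z x by (auto simp: f_def intro!: prod_nonneg bump_nonneg)
  have ff: "(\<Sum>z\<in>Z. f z x * f z y) =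
      (\<Prod>i<k. \<Sum>z\<in>Z1. bump (T x i - real_of_int z) * bump (T y i - real_of_int z))" for x y
    unfolding Z_def f_def prod.distrib[symmetric] using finZ1 by (subst prod_sum_PiE) auto
  have f1: "(\<Sum>z\<in>Z. (f z x)\<^sup>2) = 1" if "x \<in> C" for x
  proof -
    have "(\<Sum>z\<in>Z1. bump (T x i - real_of_int z) * bump (T x i - real_of_int z)) = 1" if "i < k" for i
      using sum_bump_sq[OF finZ1 subZ1[OF \<open>x \<in> C\<close> that]] by (simp add: power2_eq_square)
    then show ?thesis using ff[of x x] by (simp add: power2_eq_square)
  qed
  have min_f: "(\<Sum>z\<in>Z. min ((f z x)\<^sup>2) ((f z y)\<^sup>2)) \<ge> 1 - 4 * sqrt (\<Sum>i<k. (T x i - T y i)\<^sup>2)"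
    if "x \<in> C" "y \<in> C" for x y
  proof -
    define h where "h = (\<lambda>i. 1 - (\<Sum>z\<in>Z1. bump (T x i - real_of_int z) * bump (T y i - real_of_int z)))"
    have h: "0 \<le> h i" "h i \<le> 8 * (T x i - T y i)\<^sup>2" "h i \<le> 1" if "i < k" for i
    proof -
      show "0 \<le> h i" "h i \<le> 8 * (T x i - T y i)\<^sup>2"
        using sum_bump_prod[OF finZ1 subZ1 subZ1] \<open>x \<in> C\<close> \<open>y \<in> C\<close> that by (auto simp: h_def)
      show "h i \<le> 1"
        unfolding h_def by (simp add: sum_nonneg bump_nonneg)
    qed
    \<comment> \<open>Weierstrass's product inequality turns multiplied affinities into added
      coordinate defects.\<close>
    have "1 - (\<Sum>i<k. h i) \<le> (\<Prod>i<k. 1 - h i)"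
      using h by (intro Weierstrass_prod_ineq) auto
    also have "\<dots> = (\<Sum>z\<in>Z. f z x * f z y)"
      by (simp add: ff h_def)
    finally have "1 - (\<Sum>z\<in>Z. f z x * f z y) \<le> (\<Sum>i<k. h i)" by simp
    also have "\<dots> \<le> 8 * (\<Sum>i<k. (T x i - T y i)\<^sup>2)"
      unfolding sum_distrib_left using h by (intro sum_mono) auto
    finally have "1 - sqrt (2 * (8 * (\<Sum>i<k. (T x i - T y i)\<^sup>2))) \<le> (\<Sum>z\<in>Z. min ((f z x)\<^sup>2) ((f z y)\<^sup>2))"
      using f0 f1 that by (intro sum_min_ge_of_hellinger) (auto intro!: sum_nonneg)
    moreover have "sqrt (2 * (8 * s)) = 4 * sqrt s" for s
      using real_sqrt_mult[of 16 s] by simp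
    ultimately show ?thesis by simp
  qed
  have "\<exists>w. (\<forall>S. w S \<ge> 0) \<and> (\<forall>S. w S \<noteq> 0 \<longrightarrow> S \<subseteq> {x\<in>C. (f z x)\<^sup>2 > 0}) \<and>
           (\<forall>x\<in>C. \<forall>y\<in>C. joint_weight w C x y = min ((f z x)\<^sup>2) ((f z y)\<^sup>2))" for z
    using assms by (intro layer_cake_weights) auto
  from choice[OF allI, OF this] obtain w where w: "\<forall>z. (\<forall>S. w z S \<ge> 0) \<and>
      (\<forall>S. w z S \<noteq> 0 \<longrightarrow> S \<subseteq> {x\<in>C. (f z x)\<^sup>2 > 0}) \<and>
      (\<forall>x\<in>C. \<forall>y\<in>C. joint_weight (w z) C x y = min ((f z x)\<^sup>2) ((f z y)\<^sup>2))"
    by (rule exE)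
  have w0: "w z S \<ge> 0" and w1: "w z S \<noteq> 0 \<Longrightarrow> S \<subseteq> {x\<in>C. (f z x)\<^sup>2 > 0}"
    and w2: "x \<in> C \<Longrightarrow> y \<in> C \<Longrightarrow> joint_weight (w z) C x y = min ((f z x)\<^sup>2) ((f z y)\<^sup>2)" for z S x y
    using w by simp_all
  define W where "W = (\<lambda>S. \<Sum>z\<in>Z. w z S)"
  have jW: "joint_weight W C x y = (\<Sum>z\<in>Z. min ((f z x)\<^sup>2) ((f z y)\<^sup>2))" if "x \<in> C" "y \<in> C" for x y
    unfolding w2[OF that, symmetric] unfolding joint_weight_def W_def sum_distrib_right
    by (rule sum.swap)
  show ?thesis
  proof (intro exI[of _ W], unfold stochastic_cover_def, intro conjI allI ballI impI)
    show "0 \<le> W S" for S using w0 by (simp add: W_def sum_nonneg)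
    fix S assume "W S \<noteq> 0"
    then obtain z where "z \<in> Z" "w z S \<noteq> 0" unfolding W_def by (meson sum.neutral)
    note S = w1[OF this(2)]
    then show "S \<subseteq> C" by auto
    fix x y i assume xy: "x \<in> S" "y \<in> S" and i: "i < k"
    have "\<bar>T x i - real_of_int (z i)\<bar> < 1" if "x \<in> S" for x
    proof (rule ccontr)
      assume "\<not> \<bar>T x i - real_of_int (z i)\<bar> < 1"
      then have "f z x = 0"
        unfolding f_def using i by (intro prod_zero) (auto intro!: bump_eq_0 bexI[of _ i])
      then show False using S that by auto
    qed
    from this[OF xy(1)] this[OF xy(2)] show "\<bar>T x i - T y i\<bar> \<le> 2" by linarith
  next
    show "joint_weight W C x x = 1" if "x \<in> C" for x
      using jW[OF that that] f1[OF that] by simp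
  next
    show "1 - 4 * sqrt (\<Sum>i<k. (T x i - T y i)\<^sup>2) \<le> joint_weight W C x y" if "x \<in> C" "y \<in> C" for x y
      using jW[OF that] min_f[OF that] by simp
  qed
qed

section \<open>Covers in Euclidean space\<close>

text \<open>\<open>A\<close> encodes a sign vector: plus on \<open>A\<close>, minus off it. Sums
  over \<open>Pow {..<d}\<close> are \<open>2 ^ d\<close> times expectations over uniform
  signs.\<close>

definition signed_sum :: "nat \<Rightarrow> nat set \<Rightarrow> (nat \<Rightarrow> real) \<Rightarrow> real" where
  "signed_sum d A u = (\<Sum>i<d. if i \<in> A then u i else - u i)"

lemma signed_sum_diff: "signed_sum d A (\<lambda>i. u i - v i) = signed_sum d A u - signed_sum d A v"
  unfolding signed_sum_def sum_subtractf[symmetric] by (intro sum.cong) auto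

text \<open>Splits on the last sign; this drives the induction for both moments.\<close>

lemma sum_Pow_Suc:
  fixes F :: "nat set \<Rightarrow> real"
  shows "(\<Sum>A\<in>Pow {..<Suc d}. F A) = (\<Sum>A\<in>Pow {..<d}. F A + F (insert d A))"
proof -
  have inj: "inj_on (insert d) (Pow {..<d})"
    unfolding inj_on_def by (metis Diff_insert_absorb PowD lessThan_iff less_irrefl subsetD)
  have "Pow {..<d} \<inter> insert d ` Pow {..<d} = {}" by auto
  then have "(\<Sum>A\<in>Pow {..<Suc d}. F A) = (\<Sum>A\<in>Pow {..<d}. F A) + (\<Sum>A\<in>insert d ` Pow {..<d}. F A)"
    unfolding lessThan_Suc Pow_insert by (intro sum.union_disjoint) auto
  then show ?thesis
    by (simp add: sum.reindex[OF inj] sum.distrib)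
qed

lemma signed_sum_Suc:
  assumes "A \<in> Pow {..<d}"
  shows "signed_sum (Suc d) A u = signed_sum d A u - u d"
    and "signed_sum (Suc d) (insert d A) u = signed_sum d A u + u d"
proof -
  show "signed_sum (Suc d) A u = signed_sum d A u - u d"
    using assms by (auto simp: signed_sum_def)
  have "(\<Sum>i<d. if i \<in> insert d A then u i else - u i) = (\<Sum>i<d. if i \<in> A then u i else - u i)"
    by (intro sum.cong) auto
  then show "signed_sum (Suc d) (insert d A) u = signed_sum d A u + u d"
    by (simp add: signed_sum_def)
qed

lemma signed_sum_second_moment:
  "(\<Sum>A\<in>Pow {..<d}. (signed_sum d A u)\<^sup>2) = 2 ^ d * (\<Sum>i<d. (u i)\<^sup>2)"
proof (induction d)
  case (Suc d)
  have "(\<Sum>A\<in>Pow {..<Suc d}. (signed_sum (Suc d) A u)\<^sup>2) =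
      (\<Sum>A\<in>Pow {..<d}. 2 * (signed_sum d A u)\<^sup>2 + 2 * (u d)\<^sup>2)"
    unfolding sum_Pow_Suc
    by (intro sum.cong refl) (simp add: signed_sum_Suc power2_sum power2_diff)
  also have "\<dots> = 2 * (\<Sum>A\<in>Pow {..<d}. (signed_sum d A u)\<^sup>2) + 2 ^ d * (2 * (u d)\<^sup>2)"
    by (simp add: sum.distrib card_Pow flip: sum_distrib_left)
  finally show ?case
    unfolding Suc by (simp add: algebra_simps)
qed (simp add: signed_sum_def)

text \<open>Khintchine's inequality for the fourth moment, with constant 3: odd powers cancel
  between the two values of the last sign.\<close>

lemma signed_sum_fourth_moment:
  "(\<Sum>A\<in>Pow {..<d}. (signed_sum d A u) ^ 4) \<le> 3 * 2 ^ d * (\<Sum>i<d. (u i)\<^sup>2)\<^sup>2"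
proof (induction d)
  case (Suc d)
  define s where "s = (\<Sum>i<d. (u i)\<^sup>2)"
  have p4: "(a - b) ^ 4 + (a + b) ^ 4 = 2 * a ^ 4 + 12 * b\<^sup>2 * a\<^sup>2 + 2 * b ^ 4" for a b :: real
    by (simp add: power4_eq_xxxx power2_eq_square algebra_simps)
  have "(\<Sum>A\<in>Pow {..<Suc d}. (signed_sum (Suc d) A u) ^ 4) =
      (\<Sum>A\<in>Pow {..<d}. 2 * (signed_sum d A u) ^ 4 + 12 * (u d)\<^sup>2 * (signed_sum d A u)\<^sup>2 + 2 * u d ^ 4)"
    unfolding sum_Pow_Suc by (intro sum.cong refl) (simp only: signed_sum_Suc p4)
  also have "\<dots> = 2 * (\<Sum>A\<in>Pow {..<d}. (signed_sum d A u) ^ 4) + 12 * (u d)\<^sup>2 * (2 ^ d * s) + 2 ^ d * (2 * u d ^ 4)"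
    unfolding s_def signed_sum_second_moment[symmetric]
    by (simp add: sum.distrib card_Pow flip: sum_distrib_left)
  \<comment> \<open>The last term is enlarged from 2 to 6 times \<open>u d ^ 4\<close> so that the
    right side completes to a square.\<close>
  also have "\<dots> \<le> 2 * (3 * 2 ^ d * s\<^sup>2) + 12 * (u d)\<^sup>2 * (2 ^ d * s) + 2 ^ d * (6 * u d ^ 4)"
    using Suc by (intro add_mono mult_left_mono) (auto simp: s_def)
  also have "\<dots> = 3 * 2 ^ Suc d * (s + (u d)\<^sup>2)\<^sup>2"
    by (simp add: power2_sum algebra_simps power4_eq_xxxx power2_eq_square)
  finally show ?case by (simp add: s_def)
qed (simp add: signed_sum_def)

text \<open>Paley--Zygmund, in the pointwise form \<open>t \<le> t\<^sup>2 / (6 s) + 3 s / 2\<close> with \<open>t\<close> the squared sum.\<close>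

lemma signed_sum_small_ball:
  fixes u :: "nat \<Rightarrow> real"
  assumes s_def: "s = (\<Sum>i<d. (u i)\<^sup>2)"
    and "s > 0"
  shows "real (card {A\<in>Pow {..<d}. (signed_sum d A u)\<^sup>2 \<le> s / 4}) \<le> 5 / 6 * 2 ^ d"
proof -
  define B where "B = {A\<in>Pow {..<d}. (signed_sum d A u)\<^sup>2 \<le> s / 4}"
  have fin: "finite (Pow {..<d})" by simp
  have B: "B \<subseteq> Pow {..<d}" by (auto simp: B_def)
  have pt: "(signed_sum d A u)\<^sup>2 \<le> s / 4 + (signed_sum d A u) ^ 4 / (6 * s) + 3 / 2 * s * of_bool (A \<in> Pow {..<d} - B)"
    if "A \<in> Pow {..<d}" for A
  proof (cases "A \<in> B")
    case True
    then have "(signed_sum d A u)\<^sup>2 \<le> s / 4" by (simp add: B_def)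
    moreover have "0 \<le> (signed_sum d A u) ^ 4 / (6 * s)" using assms(2) by simp
    ultimately show ?thesis using True by simp
  next
    case False
    define t where "t = (signed_sum d A u)\<^sup>2"
    have "0 \<le> (t - 3 * s)\<^sup>2" by simp
    then have "6 * s * t \<le> t\<^sup>2 + 9 * s\<^sup>2" by (simp add: power2_diff power_mult_distrib mult_ac)
    then have "t \<le> t\<^sup>2 / (6 * s) + 3 / 2 * s"
      using assms(2) by (simp add: field_simps power2_eq_square)
    moreover have "t\<^sup>2 = (signed_sum d A u) ^ 4" by (simp add: t_def flip: power_mult)
    ultimately show ?thesis using False that assms(2) by (simp add: t_def)
  qed
  have "2 ^ d * s = (\<Sum>A\<in>Pow {..<d}. (signed_sum d A u)\<^sup>2)"
    by (simp add: signed_sum_second_moment s_def)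
  also have "\<dots> \<le> (\<Sum>A\<in>Pow {..<d}. s / 4 + (signed_sum d A u) ^ 4 / (6 * s) + 3 / 2 * s * of_bool (A \<in> Pow {..<d} - B))"
    by (intro sum_mono pt)
  also have "\<dots> = 2 ^ d * (s / 4) + (\<Sum>A\<in>Pow {..<d}. (signed_sum d A u) ^ 4) / (6 * s) +
      3 / 2 * s * (\<Sum>A\<in>Pow {..<d}. of_bool (A \<in> Pow {..<d} - B))"
    by (simp only: sum.distrib sum_divide_distrib sum_distrib_left) (simp add: card_Pow)
  also have "(\<Sum>A\<in>Pow {..<d}. of_bool (A \<in> Pow {..<d} - B)) = real (card (Pow {..<d} - B))"
    by (subst sum_of_bool_eq) (auto intro!: arg_cong[of _ _ card])
  also have "\<dots> = 2 ^ d - real (card B)"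
    using B card_mono[OF fin B] finite_subset[OF B fin]
    by (subst card_Diff_subset) (auto simp: card_Pow of_nat_diff)
  also have "(\<Sum>A\<in>Pow {..<d}. (signed_sum d A u) ^ 4) / (6 * s) \<le> 3 * 2 ^ d * s\<^sup>2 / (6 * s)"
    unfolding s_def by (intro divide_right_mono signed_sum_fourth_moment) (use assms(2) in \<open>simp add: s_def\<close>)
  also have "3 * 2 ^ d * s\<^sup>2 / (6 * s) = 2 ^ d * s / 2"
    using assms(2) by (simp add: power2_eq_square)
  \<comment> \<open>With N = 2^d, cancelling \<open>s\<close> leaves N \<le> 3 N / 4 + 3 / 2 (N -
    |B|), which is |B| \<le> 5 N / 6.\<close>
  finally have "s * 2 ^ d \<le> s * (2 ^ d / 4 + 2 ^ d / 2 + 3 / 2 * (2 ^ d - real (card B)))"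
    by (simp add: field_simps)
  then have "2 ^ d \<le> 2 ^ d / 4 + 2 ^ d / 2 + 3 / 2 * (2 ^ d - real (card B))"
    using assms(2) by (simp only: mult_le_cancel_left_pos)
  moreover have "c \<le> 5 / 6 * N" if "N \<le> N / 4 + N / 2 + 3 / 2 * (N - c)" for c N :: real
    using that by (simp add: field_simps)
  ultimately have "real (card B) \<le> 5 / 6 * 2 ^ d" by blast
  then show ?thesis by (simp only: B_def)
qed

text \<open>Independence of the rows of a random matrix: each row other than \<open>j\<close>
  contributes just the factor \<open>card B\<close>.\<close>

lemma sum_PiE_marginal:
  fixes g :: "'b \<Rightarrow> real" and m :: real
  assumes "finite B" "sum g B = card B * m" "j < k"
  shows "(\<Sum>A\<in>PiE {..<k} (\<lambda>_. B). g (A j)) = card B ^ k * m"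
proof -
  have prod_if: "(\<Prod>i<k. if i = j then v i else 1) = v j" for v :: "nat \<Rightarrow> real"
    using assms(3) by (simp add: prod.delta)
  have "(\<Sum>A\<in>PiE {..<k} (\<lambda>_. B). g (A j)) = (\<Prod>i<k. \<Sum>b\<in>B. if i = j then g b else 1)"
    using assms(1) prod_if[of "\<lambda>i. g (A i)" for A] by (subst prod_sum_PiE) simp_all
  also have "\<dots> = (\<Prod>i<k. card B * (if i = j then m else 1))"
    using assms(2) by (intro prod.cong) auto
  also have "\<dots> = card B ^ k * m"
    using prod_if[of "\<lambda>_. m"] by (simp add: prod.distrib)
  finally show ?thesis .
qed

section \<open>Euclidean covers from the dimension and from the number of points\<close>

definition l2_dist :: "nat \<Rightarrow> (nat \<Rightarrow> real) \<Rightarrow> (nat \<Rightarrow> real) \<Rightarrow> real" where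
  "l2_dist d x y = sqrt (\<Sum>i<d. (x i - y i)\<^sup>2)"

lemma l2_dist_nonneg: "l2_dist d x y \<ge> 0"
  by (simp add: l2_dist_def sum_nonneg)

lemma sqrt_sum_scale:
  assumes "a \<ge> (0::real)"
  shows "sqrt (\<Sum>i\<in>I. (a * f i)\<^sup>2) = a * sqrt (\<Sum>i\<in>I. (f i)\<^sup>2)"
  using assms unfolding power_mult_distrib sum_distrib_left[symmetric]
  by (simp add: real_sqrt_mult)

lemma l2_cover_dimension:
  fixes T :: "'a \<Rightarrow> nat \<Rightarrow> real"
  assumes "finite C" "d \<ge> 1" "\<Delta> > 0"
  shows "\<exists>W. stochastic_cover C (\<lambda>S. \<forall>x\<in>S. \<forall>y\<in>S. l2_dist d (T x) (T y) \<le> \<Delta>)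
           (\<lambda>x y. 8 * sqrt d / \<Delta> * l2_dist d (T x) (T y)) W"
proof -
  \<comment> \<open>A cell of width 2 in \<open>d\<close> coordinates has diameter at most
    \<open>2 * sqrt d\<close>; this scaling brings it to \<open>\<Delta>\<close> and makes the
    defect constant 4 * 2.\<close>
  define a where "a = 2 * sqrt d / \<Delta>"
  have a: "a > 0" using assms by (simp add: a_def)
  have scale: "sqrt (\<Sum>i<d. (a * T x i - a * T y i)\<^sup>2) = a * l2_dist d (T x) (T y)" for x y
    using sqrt_sum_scale[of a "\<lambda>i. T x i - T y i" "{..<d}"] a
    by (simp add: l2_dist_def right_diff_distrib)
  obtain W where W: "stochastic_cover C (\<lambda>S. \<forall>x\<in>S. \<forall>y\<in>S. \<forall>i<d. \<bar>a * T x i - a * T y i\<bar> \<le> 2)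
       (\<lambda>x y. 4 * sqrt (\<Sum>i<d. (a * T x i - a * T y i)\<^sup>2)) W"
    using lattice_cover[OF assms(1), of d "\<lambda>x i. a * T x i"] by blast
  have "l2_dist d (T x) (T y) \<le> \<Delta>" if le: "\<forall>i<d. \<bar>a * T x i - a * T y i\<bar> \<le> 2" for x y
  proof -
    have "(\<Sum>i<d. (a * T x i - a * T y i)\<^sup>2) \<le> (\<Sum>i<d. 2\<^sup>2)"
    proof (intro sum_mono)
      fix i assume "i \<in> {..<d}"
      then have "\<bar>a * T x i - a * T y i\<bar> \<le> 2" using le by simp
      then show "(a * T x i - a * T y i)\<^sup>2 \<le> 2\<^sup>2"
        by (metis abs_ge_zero power2_abs power_mono)
    qed
    then have "a * l2_dist d (T x) (T y) \<le> sqrt (d * 4)"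
      unfolding scale[symmetric] by (intro real_sqrt_le_mono) simp
    also have "\<dots> = a * \<Delta>"
      using assms(3) by (simp add: a_def real_sqrt_mult)
    finally show ?thesis using a by simp
  qed
  then show ?thesis
    by (intro exI[of _ W] stochastic_cover_mono[OF W]) (simp_all add: scale, simp add: a_def)
qed

lemma sum_sqrt_le:
  fixes q :: "'b \<Rightarrow> real"
  assumes "\<And>x. x \<in> G \<Longrightarrow> q x \<ge> 0"
  shows "(\<Sum>x\<in>G. sqrt (q x)) \<le> sqrt (card G * (\<Sum>x\<in>G. q x))"
proof (rule real_le_rsqrt)
  show "(\<Sum>x\<in>G. sqrt (q x))\<^sup>2 \<le> card G * (\<Sum>x\<in>G. q x)"
    using Cauchy_Schwarz_ineq_sum[of "\<lambda>_. 1" "\<lambda>x. sqrt (q x)" G] assms by simp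
qed

text \<open>Project by a \<open>k\<close> by \<open>d\<close> sign matrix and round the image to the
  lattice. A far pair is short in all rows with probability at most (5/6)^k, so by a union bound at
  least half of the matrices keep every far pair apart. The defect is controlled on average over
  these good matrices, by second moments and Cauchy-Schwarz.\<close>

lemma l2_cover_cardinality:
  fixes T :: "'a \<Rightarrow> nat \<Rightarrow> real"
  assumes "finite C" "card C \<le> n" "n \<ge> 2" "\<Delta> > 0"
  shows "\<exists>W. stochastic_cover C (\<lambda>S. \<forall>x\<in>S. \<forall>y\<in>S. l2_dist d (T x) (T y) \<le> \<Delta>)
           (\<lambda>x y. 112 * sqrt (ln n) / \<Delta> * l2_dist d (T x) (T y)) W"
proof -
  \<comment> \<open>18 makes (5/6)^k \<le> exp (- k / 6) \<le> n^(-3), which beats the n^2 pairs. As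
    ln n \<ge> 1/2, rounding up costs at most 2 ln n.\<close>
  define k where "k = nat \<lceil>18 * ln (real n)\<rceil>"
  have ln2: "ln (real n) \<ge> 1 / 2"
  proof -
    have "1 / 2 \<le> ln (2 :: real)" using ln2_ge_two_thirds by simp
    also have "\<dots> \<le> ln (real n)" using assms(3) by simp
    finally show ?thesis .
  qed
  have k: "18 * ln (real n) \<le> k" "k \<le> 20 * ln (real n)"
    unfolding k_def using ln2 by linarith+
  define M where "M = PiE {..<k} (\<lambda>_. Pow {..<d})"
  have finM: "finite M" by (auto simp: M_def intro: finite_PiE)
  have cardM: "real (card M) = (2 ^ d) ^ k"
    by (simp add: M_def card_PiE card_Pow)
  define s where "s = (\<lambda>x y. \<Sum>i<d. (T x i - T y i)\<^sup>2)"
  define R where "R = (\<lambda>A x y. signed_sum d A (\<lambda>i. T x i - T y i))"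
  have s0: "s x y \<ge> 0" for x y by (simp add: s_def sum_nonneg)
  \<comment> \<open>The good matrices: some row shows every far pair at more than half its
    length.\<close>
  define G where "G = {A\<in>M. \<forall>x\<in>C. \<forall>y\<in>C. l2_dist d (T x) (T y) > \<Delta> \<longrightarrow> (\<exists>j<k. (R (A j) x y)\<^sup>2 > s x y / 4)}"
  define Bad where "Bad = (\<lambda>x y. PiE {..<k} (\<lambda>_. {A\<in>Pow {..<d}. (R A x y)\<^sup>2 \<le> s x y / 4}))"
  define F where "F = {z\<in>C \<times> C. l2_dist d (T (fst z)) (T (snd z)) > \<Delta>}"
  have finF: "finite F" "card F \<le> n ^ 2"
  proof -
    show "finite F" using assms(1) by (simp add: F_def)
    have "card F \<le> card (C \<times> C)"
      using assms(1) by (intro card_mono) (auto simp: F_def)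
    also have "\<dots> \<le> n ^ 2"
      using assms(2) by (simp add: card_cartesian_product power2_eq_square mult_le_mono)
    finally show "card F \<le> n ^ 2" .
  qed
  have bad: "real (card (Bad (fst z) (snd z))) \<le> (5 / 6) ^ k * (2 ^ d) ^ k" if "z \<in> F" for z
  proof -
    have "s (fst z) (snd z) > 0"
    proof -
      have "0 < l2_dist d (T (fst z)) (T (snd z))" using that assms(4) by (auto simp: F_def)
      then show ?thesis by (simp add: l2_dist_def s_def)
    qed
    then have "real (card {A\<in>Pow {..<d}. (R A (fst z) (snd z))\<^sup>2 \<le> s (fst z) (snd z) / 4}) \<le> 5 / 6 * 2 ^ d"
      unfolding R_def by (intro signed_sum_small_ball) (simp_all add: s_def)
    then have "real (card {A\<in>Pow {..<d}. (R A (fst z) (snd z))\<^sup>2 \<le> s (fst z) (snd z) / 4}) ^ k \<le> (5 / 6 * 2 ^ d) ^ k"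
      by (intro power_mono) simp_all
    then show ?thesis unfolding power_mult_distrib by (simp add: Bad_def card_PiE)
  qed
  have "M - G \<subseteq> (\<Union>z\<in>F. Bad (fst z) (snd z))"
  proof
    fix A assume A: "A \<in> M - G"
    then obtain x y where xy: "x \<in> C" "y \<in> C" "l2_dist d (T x) (T y) > \<Delta>"
      "\<forall>j<k. \<not> (R (A j) x y)\<^sup>2 > s x y / 4"
      by (auto simp: G_def)
    then have "A \<in> Bad x y"
      using A by (auto simp: Bad_def M_def PiE_iff not_less)
    then show "A \<in> (\<Union>z\<in>F. Bad (fst z) (snd z))"
      using xy by (intro UN_I[of "(x, y)"]) (auto simp: F_def)
  qed
  then have "card (M - G) \<le> card (\<Union>z\<in>F. Bad (fst z) (snd z))"
    using finF(1) by (intro card_mono finite_UN_I) (auto simp: Bad_def intro!: finite_PiE)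
  also have "\<dots> \<le> (\<Sum>z\<in>F. card (Bad (fst z) (snd z)))"
    using finF(1) by (rule card_UN_le)
  finally have "real (card (M - G)) \<le> (\<Sum>z\<in>F. real (card (Bad (fst z) (snd z))))"
    by (metis of_nat_le_iff of_nat_sum)
  also have "\<dots> \<le> card F * ((5 / 6) ^ k * (2 ^ d) ^ k)"
    by (intro sum_bounded_above bad)
  also have "\<dots> \<le> (n ^ 2) * ((5 / 6) ^ k * card M)"
    unfolding cardM using finF(2) by (intro mult_right_mono) (auto simp flip: of_nat_power)
  also have "\<dots> \<le> 1 / 2 * card M"
  proof -
    have "(5 / 6 :: real) \<le> exp (- 1 / 6)" using exp_ge_add_one_self[of "- 1 / 6 :: real"] by simp
    then have "(5 / 6 :: real) ^ k \<le> exp (- 1 / 6) ^ k" by (intro power_mono) auto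
    also have "\<dots> = exp (- (k / 6))" by (simp flip: exp_of_nat_mult)
    also have "\<dots> \<le> exp (- (3 * ln (real n)))" using k(1) by simp
    also have "\<dots> = 1 / real n ^ 3"
      using assms(3) by (simp add: exp_minus exp_of_nat_mult[of 3, simplified] divide_inverse)
    finally have "real n ^ 2 * (5 / 6) ^ k \<le> real n ^ 2 * (1 / real n ^ 3)"
      by (intro mult_left_mono) auto
    also have "\<dots> = 1 / real n" using assms(3) by (simp add: power2_eq_square power3_eq_cube)
    also have "\<dots> \<le> 1 / 2" using assms(3) by (simp add: field_simps)
    finally have "real n ^ 2 * (5 / 6) ^ k * card M \<le> 1 / 2 * card M"
      by (intro mult_right_mono) auto
    then show ?thesis by (simp add: mult.assoc)
  qed
  finally have half: "real (card M) \<le> 2 * card G"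
  proof -
    assume *: "real (card (M - G)) \<le> 1 / 2 * real (card M)"
    have "G \<subseteq> M" by (auto simp: G_def)
    then have "card (M - G) = card M - card G" "card G \<le> card M"
      using finM by (auto simp: card_Diff_subset finite_subset card_mono)
    with * show ?thesis by linarith
  qed
  have G: "finite G" "G \<subseteq> M" using finM by (auto simp: G_def)
  have "real (card M) > 0" unfolding cardM by simp
  then have G0: "card G > 0" using half by linarith
  \<comment> \<open>Passing from all matrices to \<open>G\<close> costs at most a factor 2, since
    \<open>G\<close> is at least half of \<open>M\<close>.\<close>
  have second: "(\<Sum>A\<in>G. \<Sum>j<k. (R (A j) x y)\<^sup>2) \<le> 2 * card G * (k * s x y)" for x y
  proof -
    have "(\<Sum>A\<in>G. \<Sum>j<k. (R (A j) x y)\<^sup>2) \<le> (\<Sum>A\<in>M. \<Sum>j<k. (R (A j) x y)\<^sup>2)"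
      using finM G(2) by (intro sum_mono2) (auto intro: sum_nonneg)
    also have "\<dots> = (\<Sum>j<k. \<Sum>A\<in>M. (R (A j) x y)\<^sup>2)" by (rule sum.swap)
    also have "\<dots> = (\<Sum>j<k. card M * s x y)"
    proof (intro sum.cong refl)
      fix j assume "j \<in> {..<k}"
      then have "(\<Sum>A\<in>M. (R (A j) x y)\<^sup>2) = card (Pow {..<d}) ^ k * s x y"
        unfolding M_def R_def s_def
        by (intro sum_PiE_marginal) (simp_all add: signed_sum_second_moment card_Pow)
      then show "(\<Sum>A\<in>M. (R (A j) x y)\<^sup>2) = card M * s x y"
        by (simp add: cardM card_Pow)
    qed
    also have "\<dots> = card M * (k * s x y)" by simp
    also have "\<dots> \<le> 2 * card G * (k * s x y)"
      using half s0 by (intro mult_right_mono) auto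
    finally show ?thesis .
  qed
  have "\<exists>W. stochastic_cover C (\<lambda>S. \<forall>x\<in>S. \<forall>y\<in>S. l2_dist d (T x) (T y) \<le> \<Delta>)
           (\<lambda>x y. 16 / \<Delta> * sqrt (\<Sum>j<k. (R (A j) x y)\<^sup>2)) W" if A: "A \<in> G" for A
  proof -
    \<comment> \<open>With the scale 4 / \<Delta>, coordinates within 2 mean that every row has size
      at most \<Delta> / 2, which a good matrix excludes for far pairs. The defect constant becomes
      4 * 4 = 16.\<close>
    define t where "t = (\<lambda>x j. 4 / \<Delta> * signed_sum d (A j) (T x))"
    have t: "t x j - t y j = 4 / \<Delta> * R (A j) x y" for x y j
      by (simp add: t_def R_def signed_sum_diff right_diff_distrib)
    obtain W where W: "stochastic_cover C (\<lambda>S. \<forall>x\<in>S. \<forall>y\<in>S. \<forall>j<k. \<bar>t x j - t y j\<bar> \<le> 2)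
       (\<lambda>x y. 4 * sqrt (\<Sum>j<k. (t x j - t y j)\<^sup>2)) W"
      using lattice_cover[OF assms(1), of k t] by blast
    have "l2_dist d (T x) (T y) \<le> \<Delta>"
      if xy: "x \<in> C" "y \<in> C" and le: "\<forall>j<k. \<bar>t x j - t y j\<bar> \<le> 2" for x y
    proof (rule ccontr)
      assume far: "\<not> l2_dist d (T x) (T y) \<le> \<Delta>"
      then obtain j where j: "j < k" "(R (A j) x y)\<^sup>2 > s x y / 4"
        using A xy unfolding G_def not_le by blast
      have "\<bar>R (A j) x y\<bar> \<le> \<Delta> / 2"
        using le[rule_format, OF j(1)] assms(4) by (simp add: t abs_mult field_simps)
      then have "(R (A j) x y)\<^sup>2 \<le> (\<Delta> / 2)\<^sup>2"
        by (metis abs_ge_zero power2_abs power_mono)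
      moreover have "\<Delta>\<^sup>2 \<le> (l2_dist d (T x) (T y))\<^sup>2"
        using far assms(4) by (intro power_mono) auto
      then have "\<Delta>\<^sup>2 \<le> s x y"
        using s0 by (simp add: l2_dist_def s_def)
      ultimately show False using j(2) by (simp add: power_divide)
    qed
    moreover have "4 * sqrt (\<Sum>j<k. (t x j - t y j)\<^sup>2) = 16 / \<Delta> * sqrt (\<Sum>j<k. (R (A j) x y)\<^sup>2)" for x y
      unfolding t using assms(4) by (subst sqrt_sum_scale) simp_all
    ultimately show ?thesis
      by (intro exI[of _ W] stochastic_cover_mono[OF W]) (auto simp: subset_iff)
  qed
  then have "\<forall>A\<in>G. \<exists>W. stochastic_cover C (\<lambda>S. \<forall>x\<in>S. \<forall>y\<in>S. l2_dist d (T x) (T y) \<le> \<Delta>)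
           (\<lambda>x y. 16 / \<Delta> * sqrt (\<Sum>j<k. (R (A j) x y)\<^sup>2)) W" by (rule ballI)
  from bchoice[OF this] obtain W where W: "\<forall>A\<in>G. stochastic_cover C
      (\<lambda>S. \<forall>x\<in>S. \<forall>y\<in>S. l2_dist d (T x) (T y) \<le> \<Delta>)
      (\<lambda>x y. 16 / \<Delta> * sqrt (\<Sum>j<k. (R (A j) x y)\<^sup>2)) (W A)" by (rule exE)
  have avg: "(\<Sum>A\<in>G. 16 / \<Delta> * sqrt (\<Sum>j<k. (R (A j) x y)\<^sup>2)) / card G \<le>
      112 * sqrt (ln n) / \<Delta> * l2_dist d (T x) (T y)" for x y
  proof -
    have "(\<Sum>A\<in>G. sqrt (\<Sum>j<k. (R (A j) x y)\<^sup>2)) \<le> sqrt (card G * (\<Sum>A\<in>G. \<Sum>j<k. (R (A j) x y)\<^sup>2))"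
      by (rule sum_sqrt_le) (simp add: sum_nonneg)
    also have "\<dots> \<le> sqrt (card G * (2 * card G * (k * s x y)))"
      using second by (intro real_sqrt_le_mono mult_left_mono) auto
    \<comment> \<open>2 k \<le> 40 ln n is rounded up to 49 ln n, a perfect square times ln n; then
      16 * 7 = 112.\<close>
    also have "\<dots> \<le> sqrt (card G * (2 * card G * (49 / 2 * ln n * s x y)))"
      using k ln2 s0 by (intro real_sqrt_le_mono mult_left_mono mult_right_mono) auto
    also have "\<dots> = sqrt ((7 * real (card G))\<^sup>2 * (ln n * s x y))"
      by (simp add: power2_eq_square)
    also have "\<dots> = card G * (7 * sqrt (ln n) * l2_dist d (T x) (T y))"
      unfolding real_sqrt_mult real_sqrt_abs by (simp add: s_def l2_dist_def)
    finally have "16 / \<Delta> * (\<Sum>A\<in>G. sqrt (\<Sum>j<k. (R (A j) x y)\<^sup>2)) / card G \<le>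
        16 / \<Delta> * (card G * (7 * sqrt (ln n) * l2_dist d (T x) (T y))) / card G"
      using assms(4) by (intro divide_right_mono mult_left_mono) auto
    also have "\<dots> = 112 * sqrt (ln n) / \<Delta> * l2_dist d (T x) (T y)"
      using G0 by simp
    finally show ?thesis by (simp add: sum_distrib_left)
  qed
  have "G \<noteq> {}" using G0 by auto
  note cov = stochastic_cover_average[OF G(1) this bspec[OF W]]
  have "stochastic_cover C (\<lambda>S. \<forall>x\<in>S. \<forall>y\<in>S. l2_dist d (T x) (T y) \<le> \<Delta>)
      (\<lambda>x y. 112 * sqrt (ln n) / \<Delta> * l2_dist d (T x) (T y)) (\<lambda>S. (\<Sum>A\<in>G. W A S) / card G)"
    using cov by (rule stochastic_cover_mono) (assumption, assumption, rule avg)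
  then show ?thesis by (intro exI)
qed

lemma l2_cover:
  fixes T :: "'a \<Rightarrow> nat \<Rightarrow> real"
  assumes "finite C" "card C \<le> n" "d \<ge> 1" "\<Delta> > 0"
  shows "\<exists>W. stochastic_cover C (\<lambda>S. \<forall>x\<in>S. \<forall>y\<in>S. l2_dist d (T x) (T y) \<le> \<Delta>)
           (\<lambda>x y. 112 * sqrt (min (ln n) d) / \<Delta> * l2_dist d (T x) (T y)) W"
proof (cases "n \<le> 1")
  case True
  then have "card C \<le> Suc 0" using assms(2) by simp
  then have eq: "\<forall>x\<in>C. \<forall>y\<in>C. x = y"
    using assms(1) by (simp add: card_le_Suc0_iff_eq)
  have "l2_dist d (T x) (T y) \<le> \<Delta>" if "x \<in> C" "y \<in> C" for x y
    using eq that assms(4) by (auto simp: l2_dist_def)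
  \<comment> \<open>For \<open>n = 0\<close> this is the convention \<open>ln 0 = 0\<close>; the
    required defect is then 0, which the one-set cover attains.\<close>
  moreover have "ln (real n) = 0" using True by (cases n) auto
  ultimately show ?thesis
    by (intro exI[of _ "\<lambda>S. of_bool (S = C)"] trivial_stochastic_cover assms(1)) auto
next
  case False
  then have n: "n \<ge> 2" by simp
  show ?thesis
  proof (cases "ln (real n) \<le> d")
    case True
    then show ?thesis using l2_cover_cardinality[OF assms(1,2) n assms(4), of d T] by simp
  next
    case False
    obtain W where W: "stochastic_cover C (\<lambda>S. \<forall>x\<in>S. \<forall>y\<in>S. l2_dist d (T x) (T y) \<le> \<Delta>)
           (\<lambda>x y. 8 * sqrt d / \<Delta> * l2_dist d (T x) (T y)) W"
      using l2_cover_dimension[OF assms(1,3,4), of T] by blast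
    have "8 * sqrt d / \<Delta> \<le> 112 * sqrt (min (ln n) d) / \<Delta>"
      using False assms(4) by (intro divide_right_mono mult_mono) auto
    then show ?thesis
      by (intro exI[of _ W] stochastic_cover_mono[OF W] mult_right_mono l2_dist_nonneg)
  qed
qed

section \<open>Mazur maps\<close>

definition mazur :: "real \<Rightarrow> real \<Rightarrow> real" where
  "mazur s a = sgn a * \<bar>a\<bar> powr s"

lemma mazur_nonneg: "a \<ge> 0 \<Longrightarrow> mazur s a = a powr s"
  by (cases "a = 0") (simp_all add: mazur_def)

lemma mazur_nonpos: "a \<le> 0 \<Longrightarrow> mazur s a = - ((- a) powr s)"
  by (cases "a = 0") (simp_all add: mazur_def)

lemma powr_superadditive:
  fixes u v :: real
  assumes "u \<ge> 0" "v \<ge> 0" "s \<ge> 1"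
  shows "u powr s + v powr s \<le> (u + v) powr s"
proof -
  have "u powr s + v powr s = u * u powr (s - 1) + v * v powr (s - 1)"
    using assms by (simp add: powr_mult_base)
  also have "\<dots> \<le> u * (u + v) powr (s - 1) + v * (u + v) powr (s - 1)"
    using assms by (intro add_mono mult_left_mono powr_mono2) auto
  also have "\<dots> = (u + v) powr s"
    using assms by (simp add: powr_mult_base flip: distrib_right)
  finally show ?thesis .
qed

lemma powr_add_le_convex:
  fixes u v :: real
  assumes "u \<ge> 0" "v \<ge> 0" "s \<ge> 1"
  shows "(u + v) powr s \<le> 2 powr (s - 1) * (u powr s + v powr s)"
proof (cases "u = 0 \<or> v = 0")
  case True
  have "1 \<le> 2 powr (s - 1)" using assms by (intro ge_one_powr_ge_zero) auto
  then show ?thesis using True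
    by (auto simp: mult_le_cancel_right1)
next
  case False
  then have "((1 - 1 / 2) *\<^sub>R u + (1 / 2) *\<^sub>R v) powr s \<le> (1 - 1 / 2) * u powr s + (1 / 2) * v powr s"
    using assms by (intro convex_onD[OF powr_convex]) auto
  moreover have "(1 - 1 / 2) *\<^sub>R u + (1 / 2) *\<^sub>R v = (u + v) / 2" by simp
  ultimately have "(u + v) powr s \<le> 2 powr s * ((u powr s + v powr s) / 2)"
    by (simp add: powr_divide field_simps)
  also have "\<dots> = 2 powr (s - 1) * (u powr s + v powr s)"
    by (simp add: powr_diff)
  finally show ?thesis .
qed

text \<open>The estimates below are invariant under swapping the arguments and under negating both.
  It remains to treat two numbers of equal sign and two of opposite sign.\<close>

lemma mazur_sign_cases [case_names nonneg nonpos mixed sym]: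
  fixes P :: "real \<Rightarrow> real \<Rightarrow> bool"
  assumes "\<And>a b. 0 \<le> b \<Longrightarrow> b \<le> a \<Longrightarrow> P a b"
    and "\<And>a b. P a b \<Longrightarrow> P (- b) (- a)"
    and "\<And>a b. b \<le> 0 \<Longrightarrow> 0 \<le> a \<Longrightarrow> P a b"
    and "\<And>a b. P a b \<Longrightarrow> P b a"
  shows "P a b"
proof -
  have *: "P a b" if "b \<le> a" for a b
  proof -
    consider "0 \<le> b" | "a \<le> 0" | "b \<le> 0" "0 \<le> a" by linarith
    then show ?thesis
    proof cases
      case 2
      then have "P (- b) (- a)" using that by (intro assms(1)) auto
      from assms(2)[OF this] show ?thesis by simp
    qed (use assms(1,3) that in auto)
  qed
  show ?thesis using *[of a b] *[of b a] assms(4) by (cases "a \<le> b") auto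
qed

lemma mazur_minus: "mazur s (- a) = - mazur s a"
  by (simp add: mazur_def sgn_minus)

text \<open>Equal signs follow from superadditivity of the power, opposite signs from convexity.
  Equality at b = -a shows where the factor comes from.\<close>

lemma mazur_expansion:
  assumes "s \<ge> 1"
  shows "\<bar>a - b\<bar> powr s \<le> 2 powr (s - 1) * \<bar>mazur s a - mazur s b\<bar>"
proof (induction a b rule: mazur_sign_cases)
  case (nonneg a b)
  have "1 \<le> 2 powr (s - 1)" using assms by (intro ge_one_powr_ge_zero) auto
  moreover have le: "(a - b) powr s \<le> a powr s - b powr s"
    using powr_superadditive[of "a - b" b s] nonneg assms by simp
  ultimately have "1 * (a - b) powr s \<le> 2 powr (s - 1) * (a powr s - b powr s)"
    by (intro mult_mono) auto
  moreover have "0 \<le> a powr s - b powr s" using le powr_ge_zero order_trans by blast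
  ultimately show ?case using nonneg by (simp add: mazur_nonneg)
next
  case (nonpos a b)
  then show ?case by (simp add: mazur_minus)
next
  case (mixed a b)
  then show ?case
    using powr_add_le_convex[of a "- b" s] assms by (simp add: mazur_nonneg mazur_nonpos)
next
  case (sym a b)
  then show ?case by (simp add: abs_minus_commute)
qed

text \<open>For a \<ge> b > 0 the bound s \<le> 2 gives b^(s-2) \<ge> a^(s-2), which reduces the
  claim to (a - b)^2 \<ge> 0. Opposite signs follow from superadditivity.\<close>

lemma mazur_lipschitz:
  assumes s: "1 \<le> s" "s \<le> 2"
  shows "\<bar>mazur s a - mazur s b\<bar> \<le> 2 * \<bar>a - b\<bar> * (\<bar>a\<bar> + \<bar>b\<bar>) powr (s - 1)"
proof (induction a b rule: mazur_sign_cases)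
  case (nonneg a b)
  have ge: "b powr s \<le> a powr s" using nonneg s by (intro powr_mono2) auto
  have "a powr s - b powr s \<le> 2 * (a - b) * a powr (s - 1)"
  proof (cases "b = 0")
    case True
    have "a powr s = a * a powr (s - 1)" using nonneg by (simp add: powr_mult_base)
    then show ?thesis using nonneg True by simp
  next
    case False
    define t where "t = a powr (s - 2)"
    have "a powr s = a\<^sup>2 * t" "a powr (s - 1) = a * t" "b powr s = b\<^sup>2 * b powr (s - 2)"
      using nonneg False powr_add[of a 2 "s - 2"] powr_add[of a 1 "s - 2"] powr_add[of b 2 "s - 2"]
      by (simp_all add: t_def)
    moreover have "b\<^sup>2 * t \<le> b\<^sup>2 * b powr (s - 2)"
      unfolding t_def using nonneg False s by (intro mult_left_mono powr_mono2') auto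
    moreover have "0 \<le> (a - b)\<^sup>2 * t" by (simp add: t_def)
    ultimately show ?thesis by (simp add: power2_diff algebra_simps power2_eq_square)
  qed
  also have "\<dots> \<le> 2 * (a - b) * (a + b) powr (s - 1)"
    using nonneg s by (intro mult_left_mono powr_mono2) auto
  finally show ?case using nonneg ge by (simp add: mazur_nonneg)
next
  case (nonpos a b)
  then show ?case by (simp add: mazur_minus add.commute)
next
  case (mixed a b)
  have "a powr s + (- b) powr s \<le> (a - b) powr s"
    using powr_superadditive[of a "- b" s] mixed s by simp
  also have "\<dots> = (a - b) * (a - b) powr (s - 1)"
    using mixed by (simp add: powr_mult_base)
  also have "\<dots> \<le> 2 * (a - b) * (a - b) powr (s - 1)"
    using mixed by (intro mult_right_mono) auto
  finally show ?case using mixed by (simp add: mazur_nonneg mazur_nonpos)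
next
  case (sym a b)
  then show ?case by (simp add: abs_minus_commute add.commute)
qed

text \<open>The constant 1 in place of 2 matters: it keeps the loss per doubling of the exponent at
  16 = 2^4, hence the fourth power of p.\<close>

lemma mazur_2_lipschitz: "\<bar>mazur 2 a - mazur 2 b\<bar> \<le> 1 * \<bar>a - b\<bar> * (\<bar>a\<bar> + \<bar>b\<bar>) powr (2 - 1)"
proof (induction a b rule: mazur_sign_cases)
  case (nonneg a b)
  then show ?case
    by (simp add: mazur_nonneg power2_eq_square square_diff_square_factored abs_mult mult.commute)
next
  case (nonpos a b)
  then show ?case by (simp add: mazur_minus add.commute)
next
  case (mixed a b)
  then have "a\<^sup>2 + b\<^sup>2 \<le> (a - b) * (a - b)"
    using mult_nonneg_nonneg[of a "- b"] by (simp add: algebra_simps power2_eq_square)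
  then show ?case using mixed by (simp add: mazur_nonneg mazur_nonpos)
next
  case (sym a b)
  then show ?case by (simp add: abs_minus_commute add.commute)
qed

text \<open>Young's inequality on normalised terms. The exponents are weights with sum 1, so the
  degenerate weight 0, which occurs for \<open>s = 1\<close>, is included.\<close>

lemma holder_sum:
  fixes u v :: "'i \<Rightarrow> real"
  assumes "\<alpha> \<ge> 0" "\<beta> \<ge> 0" "\<alpha> + \<beta> = 1"
    and u: "\<And>i. i \<in> I \<Longrightarrow> u i \<ge> 0" and v: "\<And>i. i \<in> I \<Longrightarrow> v i \<ge> 0"
  shows "(\<Sum>i\<in>I. u i powr \<alpha> * v i powr \<beta>) \<le> (\<Sum>i\<in>I. u i) powr \<alpha> * (\<Sum>i\<in>I. v i) powr \<beta>"
proof (cases "finite I \<and> sum u I \<noteq> 0 \<and> sum v I \<noteq> 0")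
  case True
  define U V where "U = sum u I" and "V = sum v I"
  have UV: "U > 0" "V > 0"
    using True u v unfolding U_def V_def by (simp_all add: less_le sum_nonneg)
  have "(u i / U) powr \<alpha> * (v i / V) powr \<beta> \<le> \<alpha> * (u i / U) + \<beta> * (v i / V)" if "i \<in> I" for i
  proof (cases "u i = 0 \<or> v i = 0")
    case False
    then show ?thesis
      using u[OF that] v[OF that] UV by (intro Youngs_inequality_0 assms) auto
  qed (use u[OF that] v[OF that] UV assms in auto)
  then have "(\<Sum>i\<in>I. (u i / U) powr \<alpha> * (v i / V) powr \<beta>) \<le> (\<Sum>i\<in>I. \<alpha> * (u i / U) + \<beta> * (v i / V))"
    by (rule sum_mono)
  also have "\<dots> = 1"
    using UV assms(3)
    by (simp add: sum.distrib U_def V_def flip: sum_distrib_left sum_divide_distrib)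
  also have "(\<Sum>i\<in>I. (u i / U) powr \<alpha> * (v i / V) powr \<beta>) =
      (\<Sum>i\<in>I. u i powr \<alpha> * v i powr \<beta>) / (U powr \<alpha> * V powr \<beta>)"
    by (simp add: powr_divide sum_divide_distrib)
  finally show ?thesis
    using UV by (simp add: U_def V_def pos_divide_le_eq)
next
  case False
  then have "(\<Sum>i\<in>I. u i powr \<alpha> * v i powr \<beta>) = 0"
    using u v by (cases "finite I") (auto simp: sum_nonneg_eq_0_iff intro!: sum.neutral)
  then show ?thesis by simp
qed

section \<open>The Mazur map between l_p distances\<close>

lemma lp_dist_nonneg: "lp_dist p d x y \<ge> 0"
  by (simp add: lp_dist_def)

lemma lp_dist_shift: "lp_dist p d (\<lambda>i. x i - z i) (\<lambda>i. y i - z i) = lp_dist p d x y"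
  by (simp add: lp_dist_def)

lemma lp_dist_powr: "p > 0 \<Longrightarrow> lp_dist p d x y powr p = (\<Sum>i<d. \<bar>x i - y i\<bar> powr p)"
  by (simp add: lp_dist_def powr_powr sum_nonneg)

lemma lp_dist_mazur_expansion:
  assumes "s \<ge> 1" "q > 0"
  shows "lp_dist (q * s) d x y powr s \<le>
    2 powr (s - 1) * lp_dist q d (\<lambda>i. mazur s (x i)) (\<lambda>i. mazur s (y i))"
proof -
  have "lp_dist (q * s) d x y powr s = (\<Sum>i<d. (\<bar>x i - y i\<bar> powr s) powr q) powr (1 / q)"
    using assms by (simp add: lp_dist_def powr_powr mult.commute)
  also have "\<dots> \<le> (\<Sum>i<d. (2 powr (s - 1) * \<bar>mazur s (x i) - mazur s (y i)\<bar>) powr q) powr (1 / q)"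
    using assms by (intro powr_mono2 sum_mono mazur_expansion sum_nonneg) auto
  also have "\<dots> = 2 powr (s - 1) * lp_dist q d (\<lambda>i. mazur s (x i)) (\<lambda>i. mazur s (y i))"
    using assms by (simp add: lp_dist_def powr_mult powr_powr flip: sum_distrib_left)
  finally show ?thesis .
qed

text \<open>Hoelder with weights 1/s and (s-1)/s splits off the differences. What remains is a power
  of the l_p norm of |x| + |y|, at most 2 R by convexity.\<close>

lemma lp_dist_mazur_lipschitz:
  assumes s: "s \<ge> 1" and q: "q \<ge> 1" and K: "K \<ge> 0"
    and lip: "\<And>a b. \<bar>mazur s a - mazur s b\<bar> \<le> K * \<bar>a - b\<bar> * (\<bar>a\<bar> + \<bar>b\<bar>) powr (s - 1)"
    and R: "lp_dist (q * s) d x (\<lambda>_. 0) \<le> R" "lp_dist (q * s) d y (\<lambda>_. 0) \<le> R"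
  shows "lp_dist q d (\<lambda>i. mazur s (x i)) (\<lambda>i. mazur s (y i)) \<le>
    K * lp_dist (q * s) d x y * (2 * R) powr (s - 1)"
proof -
  define p where "p = q * s"
  have p: "p \<ge> 1" using s q mult_mono[of 1 q 1 s] by (simp add: p_def)
  have R0: "R \<ge> 0" using R(1) lp_dist_nonneg order_trans by blast
  define D E where "D = (\<Sum>i<d. \<bar>x i - y i\<bar> powr p)" and "E = (\<Sum>i<d. (\<bar>x i\<bar> + \<bar>y i\<bar>) powr p)"
  have DE: "D \<ge> 0" "E \<ge> 0" by (auto simp: D_def E_def intro: sum_nonneg)
  have norm_le: "(\<Sum>i<d. \<bar>z i\<bar> powr p) \<le> R powr p" if "lp_dist p d z (\<lambda>_. 0) \<le> R" for z
  proof -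
    have "lp_dist p d z (\<lambda>_. 0) powr p \<le> R powr p"
      using that p lp_dist_nonneg by (intro powr_mono2) auto
    then show ?thesis using p by (simp add: lp_dist_powr)
  qed
  have "E \<le> (\<Sum>i<d. 2 powr (p - 1) * (\<bar>x i\<bar> powr p + \<bar>y i\<bar> powr p))"
    unfolding E_def using p by (intro sum_mono powr_add_le_convex) auto
  also have "\<dots> = 2 powr (p - 1) * ((\<Sum>i<d. \<bar>x i\<bar> powr p) + (\<Sum>i<d. \<bar>y i\<bar> powr p))"
    by (simp add: sum_distrib_left sum.distrib distrib_left)
  also have "\<dots> \<le> 2 powr (p - 1) * (R powr p + R powr p)"
    using R norm_le by (intro mult_left_mono add_mono) (auto simp: p_def)
  also have "\<dots> = (2 * R) powr p"
    using R0 by (simp add: powr_mult powr_diff)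
  finally have E: "E \<le> (2 * R) powr p" .
  have "(\<Sum>i<d. \<bar>mazur s (x i) - mazur s (y i)\<bar> powr q) \<le>
      (\<Sum>i<d. (K * \<bar>x i - y i\<bar> * (\<bar>x i\<bar> + \<bar>y i\<bar>) powr (s - 1)) powr q)"
    using lip q by (intro sum_mono powr_mono2) auto
  also have "\<dots> = K powr q * (\<Sum>i<d. (\<bar>x i - y i\<bar> powr p) powr (1 / s) * ((\<bar>x i\<bar> + \<bar>y i\<bar>) powr p) powr ((s - 1) / s))"
    unfolding sum_distrib_left using s K
    by (intro sum.cong) (simp_all add: powr_mult powr_powr p_def mult.commute mult.left_commute)
  also have "\<dots> \<le> K powr q * (D powr (1 / s) * E powr ((s - 1) / s))"
    unfolding D_def E_def using s
    by (intro mult_left_mono holder_sum) (auto simp: field_simps)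
  finally have "lp_dist q d (\<lambda>i. mazur s (x i)) (\<lambda>i. mazur s (y i)) \<le>
      (K powr q * (D powr (1 / s) * E powr ((s - 1) / s))) powr (1 / q)"
    unfolding lp_dist_def using q by (intro powr_mono2) (auto intro: sum_nonneg)
  also have "\<dots> = K * lp_dist p d x y * E powr ((s - 1) / p)"
    using q s K by (simp add: powr_mult powr_powr lp_dist_def D_def p_def mult.commute)
  also have "\<dots> \<le> K * lp_dist p d x y * ((2 * R) powr p) powr ((s - 1) / p)"
    using E DE s p K lp_dist_nonneg by (intro mult_left_mono powr_mono2) auto
  also have "\<dots> = K * lp_dist p d x y * (2 * R) powr (s - 1)"
    using p by (simp add: powr_powr)
  finally show ?thesis by (simp add: p_def)
qed

text \<open>The points enter through a map \<open>T\<close>, so that Mazur maps and translations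
  change \<open>T\<close> while the cover stays on the same \<open>C\<close>.\<close>

definition lp_cover :: "real \<Rightarrow> nat \<Rightarrow> 'a set \<Rightarrow> ('a \<Rightarrow> nat \<Rightarrow> real) \<Rightarrow> real \<Rightarrow> real \<Rightarrow> bool" where
  "lp_cover p d C T \<Delta> L \<longleftrightarrow>
     (\<exists>W. stochastic_cover C (\<lambda>S. \<forall>x\<in>S. \<forall>y\<in>S. lp_dist p d (T x) (T y) \<le> \<Delta>)
        (\<lambda>x y. L * lp_dist p d (T x) (T y)) W)"

lemma lp_cover_mono: "lp_cover p d C T \<Delta> L \<Longrightarrow> L \<le> L' \<Longrightarrow> lp_cover p d C T \<Delta> L'"
  unfolding lp_cover_def
  by (erule exE, rule exI, erule stochastic_cover_mono) (auto intro: mult_right_mono lp_dist_nonneg)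

lemma lp_cover_trivial:
  assumes "finite C" "\<And>x y. x \<in> C \<Longrightarrow> y \<in> C \<Longrightarrow> lp_dist p d (T x) (T y) \<le> \<Delta>" "L \<ge> 0"
  shows "lp_cover p d C T \<Delta> L"
  unfolding lp_cover_def using assms
  by (intro exI[of _ "\<lambda>S. of_bool (S = C)"] trivial_stochastic_cover)
     (auto intro: mult_nonneg_nonneg lp_dist_nonneg)

text \<open>Translating a point of \<open>C\<close> to the origin puts all points in a ball of
  radius 2 \<Delta>, where the Mazur map is Lipschitz. A cover of the images is then pulled
  back.\<close>

lemma mazur_refinement:
  fixes C :: "'a set" and T :: "'a \<Rightarrow> nat \<Rightarrow> real"
  assumes s: "1 \<le> s" "s \<le> 2" and q: "q \<ge> 1" and K: "K \<ge> 0" and B: "B \<ge> 0"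
    and lip: "\<And>a b. \<bar>mazur s a - mazur s b\<bar> \<le> K * \<bar>a - b\<bar> * (\<bar>a\<bar> + \<bar>b\<bar>) powr (s - 1)"
    and hyp: "\<And>T \<Delta>. \<Delta> > 0 \<Longrightarrow> lp_cover q d C T \<Delta> (B / \<Delta>)"
    and C: "finite C" and \<Delta>: "\<Delta> > 0"
    and diam: "\<And>x y. x \<in> C \<Longrightarrow> y \<in> C \<Longrightarrow> lp_dist (q * s) d (T x) (T y) \<le> 2 * \<Delta>"
  shows "lp_cover (q * s) d C T \<Delta> (8 * K * B / \<Delta>)"
proof (cases "C = {}")
  case True
  then show ?thesis using K B \<Delta> by (intro lp_cover_trivial) auto
next
  case False
  then obtain o' where o': "o' \<in> C" by blast
  define T' where "T' = (\<lambda>x i. mazur s (T x i - T o' i))"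
  \<comment> \<open>The scale at which the expansion bound pulls sets back to diameter
    \<Delta>.\<close>
  define \<Delta>' where "\<Delta>' = \<Delta> powr s / 2 powr (s - 1)"
  have \<Delta>': "\<Delta>' > 0" using \<Delta> by (simp add: \<Delta>'_def)
  obtain W where W: "stochastic_cover C (\<lambda>S. \<forall>x\<in>S. \<forall>y\<in>S. lp_dist q d (T' x) (T' y) \<le> \<Delta>')
        (\<lambda>x y. B / \<Delta>' * lp_dist q d (T' x) (T' y)) W"
    using hyp[OF \<Delta>', of T'] unfolding lp_cover_def by blast
  have "lp_dist (q * s) d (T x) (T y) \<le> \<Delta>" if "lp_dist q d (T' x) (T' y) \<le> \<Delta>'" for x y
  proof -
    have "lp_dist (q * s) d (T x) (T y) powr s \<le> 2 powr (s - 1) * lp_dist q d (T' x) (T' y)"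
      using lp_dist_mazur_expansion[of s q d "\<lambda>i. T x i - T o' i" "\<lambda>i. T y i - T o' i"] s q
      by (simp add: lp_dist_shift T'_def)
    also have "\<dots> \<le> 2 powr (s - 1) * \<Delta>'" using that by (intro mult_left_mono) auto
    also have "\<dots> = \<Delta> powr s" by (simp add: \<Delta>'_def)
    finally show ?thesis
      using powr_less_mono2[of s \<Delta> "lp_dist (q * s) d (T x) (T y)"] s \<Delta> by linarith
  qed
  moreover have "B / \<Delta>' * lp_dist q d (T' x) (T' y) \<le> 8 * K * B / \<Delta> * lp_dist (q * s) d (T x) (T y)"
    if xy: "x \<in> C" "y \<in> C" for x y
  proof -
    have cent: "lp_dist (q * s) d (\<lambda>i. T z i - T o' i) (\<lambda>_. 0) \<le> 2 * \<Delta>" if "z \<in> C" for z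
      using diam[OF that o'] by (simp add: lp_dist_def)
    have "lp_dist q d (T' x) (T' y) \<le> K * lp_dist (q * s) d (T x) (T y) * (2 * (2 * \<Delta>)) powr (s - 1)"
      using lp_dist_mazur_lipschitz[OF s(1) q K lip cent[OF xy(1)] cent[OF xy(2)]]
      by (simp add: lp_dist_shift T'_def)
    then have "B / \<Delta>' * lp_dist q d (T' x) (T' y) \<le>
        B / \<Delta>' * (K * lp_dist (q * s) d (T x) (T y) * (2 * (2 * \<Delta>)) powr (s - 1))"
      using B \<Delta>' by (intro mult_left_mono) auto
    also have "\<dots> = 8 powr (s - 1) * (K * B / \<Delta> * lp_dist (q * s) d (T x) (T y))"
    proof -
      have "8 powr (s - 1) = 2 powr (s - 1) * (2 powr (s - 1) * 2 powr (s - 1))"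
        by (simp flip: powr_mult)
      moreover have "\<Delta> powr s = \<Delta> * \<Delta> powr (s - 1)" using \<Delta> by (simp add: powr_mult_base)
      moreover have "(2 * (2 * \<Delta>)) powr (s - 1) = 2 powr (s - 1) * (2 powr (s - 1) * \<Delta> powr (s - 1))"
        by (simp only: powr_mult)
      ultimately show ?thesis unfolding \<Delta>'_def using \<Delta> by (simp only:) simp
    qed
    \<comment> \<open>The base 8 combines 4 from the doubled radius with 2 from
      \<open>\<Delta>'\<close>; its exponent s - 1 is at most 1.\<close>
    also have "\<dots> \<le> 8 powr 1 * (K * B / \<Delta> * lp_dist (q * s) d (T x) (T y))"
      using s K B \<Delta> lp_dist_nonneg
      by (intro mult_right_mono powr_mono mult_nonneg_nonneg divide_nonneg_nonneg) auto
    finally show ?thesis by simp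
  qed
  ultimately show ?thesis
    unfolding lp_cover_def by (intro exI[of _ W] stochastic_cover_mono[OF W]) auto
qed

text \<open>Induction over scales, from one set of huge diameter down to \<Delta>. The hypothesis
  covers subsets of \<open>C\<close> because each piece is refined separately.\<close>

lemma mazur_step:
  fixes C :: "'a set" and T :: "'a \<Rightarrow> nat \<Rightarrow> real"
  assumes s: "1 \<le> s" "s \<le> 2" and q: "q \<ge> 1" and K: "K \<ge> 0" and B: "B \<ge> 0"
    and lip: "\<And>a b. \<bar>mazur s a - mazur s b\<bar> \<le> K * \<bar>a - b\<bar> * (\<bar>a\<bar> + \<bar>b\<bar>) powr (s - 1)"
    and C: "finite C"
    and hyp: "\<And>S T \<Delta>. S \<subseteq> C \<Longrightarrow> \<Delta> > 0 \<Longrightarrow> lp_cover q d S T \<Delta> (B / \<Delta>)"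
    and \<Delta>: "\<Delta> > 0"
  shows "lp_cover (q * s) d C T \<Delta> (16 * K * B / \<Delta>)"
proof -
  let ?dist = "\<lambda>x y. lp_dist (q * s) d (T x) (T y)"
  have by_scale: "lp_cover (q * s) d C T \<Delta> (16 * K * B / \<Delta>)"
    if "\<Delta> > 0" "\<And>x y. x \<in> C \<Longrightarrow> y \<in> C \<Longrightarrow> ?dist x y \<le> 2 ^ m * \<Delta>" for m \<Delta>
    using that
  proof (induction m arbitrary: \<Delta>)
    case 0
    then show ?case using K B C by (intro lp_cover_trivial) auto
  next
    case (Suc m)
    have "lp_cover (q * s) d C T (2 * \<Delta>) (16 * K * B / (2 * \<Delta>))"
      using Suc.prems by (intro Suc.IH) (auto simp: mult_ac)
    then obtain W where W: "stochastic_cover C (\<lambda>S. \<forall>x\<in>S. \<forall>y\<in>S. ?dist x y \<le> 2 * \<Delta>)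
        (\<lambda>x y. 16 * K * B / (2 * \<Delta>) * ?dist x y) W"
      unfolding lp_cover_def by (rule exE)
    have "\<exists>V. stochastic_cover S (\<lambda>S. \<forall>x\<in>S. \<forall>y\<in>S. ?dist x y \<le> \<Delta>) (\<lambda>x y. 8 * K * B / \<Delta> * ?dist x y) V"
      if S: "S \<in> {S. S \<subseteq> C \<and> (\<forall>x\<in>S. \<forall>y\<in>S. ?dist x y \<le> 2 * \<Delta>)}" for S
    proof -
      have "lp_cover (q * s) d S T \<Delta> (8 * K * B / \<Delta>)"
        using S Suc.prems(1) finite_subset[OF _ C]
        by (intro mazur_refinement[OF s q K B lip hyp]) auto
      then show ?thesis unfolding lp_cover_def .
    qed
    then have "\<forall>S\<in>{S. S \<subseteq> C \<and> (\<forall>x\<in>S. \<forall>y\<in>S. ?dist x y \<le> 2 * \<Delta>)}.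
      \<exists>V. stochastic_cover S (\<lambda>S. \<forall>x\<in>S. \<forall>y\<in>S. ?dist x y \<le> \<Delta>) (\<lambda>x y. 8 * K * B / \<Delta> * ?dist x y) V"
      by (rule ballI)
    from bchoice[OF this] obtain V where V: "\<forall>S\<in>{S. S \<subseteq> C \<and> (\<forall>x\<in>S. \<forall>y\<in>S. ?dist x y \<le> 2 * \<Delta>)}.
      stochastic_cover S (\<lambda>S. \<forall>x\<in>S. \<forall>y\<in>S. ?dist x y \<le> \<Delta>) (\<lambda>x y. 8 * K * B / \<Delta> * ?dist x y) (V S)"
      by (rule exE)
    have cov: "stochastic_cover C (\<lambda>S. \<forall>x\<in>S. \<forall>y\<in>S. ?dist x y \<le> \<Delta>)
        (\<lambda>x y. 16 * K * B / (2 * \<Delta>) * ?dist x y + 8 * K * B / \<Delta> * ?dist x y)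
        (\<lambda>S. \<Sum>K\<in>Pow C. W K * V K S)"
    proof (rule stochastic_cover_refine[OF C W])
      fix x y show "0 \<le> 8 * K * B / \<Delta> * ?dist x y"
        using K B Suc.prems(1) lp_dist_nonneg by simp
    qed (use V in simp)
    \<comment> \<open>The geometric series closes: 16 / 2 from the scale 2 \<Delta> plus 8 from the
      refinement is again 16, whatever the number of halvings.\<close>
    have "16 * K * B / (2 * \<Delta>) * t + 8 * K * B / \<Delta> * t = 16 * K * B / \<Delta> * t" for t
      using Suc.prems(1) by (simp add: field_simps)
    with cov show ?case
      unfolding lp_cover_def by (intro exI) (simp only:)
  qed
  \<comment> \<open>Inserting 0 keeps \<open>Max\<close> meaningful for empty
    \<open>C\<close>.\<close>
  define M where "M = Max (insert 0 ((\<lambda>(x, y). ?dist x y) ` (C \<times> C)))"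
  have M: "?dist x y \<le> M" if "x \<in> C" "y \<in> C" for x y
    unfolding M_def using C that by (intro Max_ge) force+
  obtain m where "M / \<Delta> < 2 ^ m" using real_arch_pow[of 2 "M / \<Delta>"] by auto
  then have "M \<le> 2 ^ m * \<Delta>" using \<Delta> by (simp add: pos_divide_less_eq)
  then show ?thesis using M by (intro by_scale[OF \<Delta>, of m]) (meson order_trans)
qed

section \<open>Recursion over the exponent\<close>

lemma lp_cover_2:
  fixes C :: "'a set"
  assumes "finite C" "card C \<le> n" "d \<ge> 1" "\<Delta> > 0"
  shows "lp_cover 2 d C T \<Delta> (112 * sqrt (min (ln n) d) / \<Delta>)"
proof -
  have "lp_dist 2 d x y = l2_dist d x y" for x y
    by (simp add: lp_dist_def l2_dist_def powr_half_sqrt sum_nonneg)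
  then show ?thesis
    using l2_cover[OF assms, of T] by (simp add: lp_cover_def)
qed

text \<open>Halving p \<open>k\<close> times lands in [2, 4), which one step with s = p / 2 links to
  l_2 at cost 16 * 2 * 112 = 3584. Each doubling uses s = 2 and costs 16.\<close>

lemma lp_cover_dyadic:
  fixes C :: "'a set"
  assumes "2 * 2 ^ k \<le> p" "p < 4 * 2 ^ k" and n: "n \<ge> 1"
    and "finite C" "card C \<le> n" "d \<ge> 1" "\<Delta> > 0"
  shows "lp_cover p d C T \<Delta> (16 ^ k * 3584 * sqrt (min (ln n) d) / \<Delta>)"
proof -
  have B: "sqrt (min (ln (real n)) (real d)) \<ge> 0" using n by simp
  show ?thesis
    using assms(1,2,4-)
  proof (induction k arbitrary: p C T \<Delta>)
    case 0
    have "lp_cover (2 * (p / 2)) d C T \<Delta> (16 * 2 * (112 * sqrt (min (ln n) d)) / \<Delta>)"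
    proof (rule mazur_step)
      show "lp_cover 2 d S T \<Delta> (112 * sqrt (min (ln n) d) / \<Delta>)" if "S \<subseteq> C" "\<Delta> > 0" for S T \<Delta>
        using that 0 finite_subset[OF that(1)] card_mono[OF _ that(1)]
        by (intro lp_cover_2) auto
    qed (use 0 B mazur_lipschitz[of "p / 2"] in auto)
    then show ?case by simp
  next
    case (Suc k)
    have p: "2 * 2 ^ k \<le> p / 2" "p / 2 < 4 * 2 ^ k" using Suc.prems(1,2) by simp_all
    have "1 \<le> (2::real) ^ k" by simp
    then have q: "1 \<le> p / 2" using p(1) by linarith
    have "lp_cover (p / 2 * 2) d C T \<Delta> (16 * 1 * (16 ^ k * 3584 * sqrt (min (ln n) d)) / \<Delta>)"
    proof (rule mazur_step[OF _ _ q])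
      show "lp_cover (p / 2) d S T \<Delta> (16 ^ k * 3584 * sqrt (min (ln n) d) / \<Delta>)"
        if "S \<subseteq> C" "\<Delta> > 0" for S T \<Delta>
        using that Suc.prems finite_subset[OF that(1)] card_mono[OF _ that(1)] p
        by (intro Suc.IH) auto
    qed (use Suc.prems B mazur_2_lipschitz in auto)
    then show ?case by (simp add: mult_ac)
  qed
qed

lemma ex_dyadic_scale:
  fixes p :: real
  assumes "p \<ge> 2"
  shows "\<exists>k. 2 * 2 ^ k \<le> p \<and> p < 4 * 2 ^ k"
proof -
  define k where "k = nat \<lfloor>log 2 (p / 2)\<rfloor>"
  have "\<lfloor>log 2 (p / 2)\<rfloor> \<ge> 0" using assms by simp
  then have "\<lfloor>log 2 (p / 2)\<rfloor> = int k" by (simp add: k_def)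
  then have "2 powr (int k) \<le> p / 2 \<and> p / 2 < 2 powr (int k + 1)"
    using assms by (subst (asm) floor_log_eq_powr_iff) auto
  then have "2 * 2 ^ k \<le> p \<and> p < 4 * 2 ^ k"
    by (simp add: powr_add powr_realpow)
  then show ?thesis by blast
qed

theorem theorem2:
  shows "\<exists>c>0. \<forall>(p::real) (d::nat) (C::(nat \<Rightarrow> real) set) (\<Delta>::real).
           p \<ge> 2 \<longrightarrow> d \<ge> 1 \<longrightarrow> finite C \<longrightarrow> C \<subseteq> real_space d \<longrightarrow> \<Delta> > 0 \<longrightarrow>
           (\<exists>D. lipschitz_decomposition (lp_dist p d) C
                   (c * p ^ 4 * sqrt (min (ln (real (card C))) (real d))) \<Delta> D)"
\<comment> \<open>As 16^k = (2^k)^4 \<le> (p / 2)^4, the cover has constant 3584 / 16 = 224; carving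
  doubles it to 448.\<close>
proof (intro exI[of _ 448] conjI allI impI)
  fix p :: real and d :: nat and C :: "(nat \<Rightarrow> real) set" and \<Delta> :: real
  assume p: "p \<ge> 2" and d: "d \<ge> 1" and C: "finite C" and \<Delta>: "\<Delta> > 0"
  define \<kappa> where "\<kappa> = sqrt (min (ln (real (card C))) (real d))"
  show "\<exists>D. lipschitz_decomposition (lp_dist p d) C (448 * p ^ 4 * \<kappa>) \<Delta> D"
  proof (cases "C = {}")
    case True
    then have "lipschitz_decomposition (lp_dist p d) C (448 * p ^ 4 * \<kappa>) \<Delta> (return_pmf {})"
      by (simp add: lipschitz_decomposition_def partition_on_empty)
    then show ?thesis by (rule exI)
  next
    case False
    with C have n: "card C \<ge> 1" by (simp add: Suc_le_eq card_gt_0_iff)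
    obtain k where k: "2 * 2 ^ k \<le> p" "p < 4 * 2 ^ k" using ex_dyadic_scale[OF p] by blast
    have "(16::real) ^ k = (2 ^ 4) ^ k" by simp
    also have "\<dots> = (2 ^ k) ^ 4" by (metis power_mult mult.commute)
    also have "\<dots> \<le> (p / 2) ^ 4" using k(1) by (intro power_mono) auto
    finally have "16 ^ k * 3584 * \<kappa> / \<Delta> \<le> (p / 2) ^ 4 * 3584 * \<kappa> / \<Delta>"
      using \<Delta> n by (intro divide_right_mono mult_right_mono) (auto simp: \<kappa>_def)
    also have "\<dots> = 224 * p ^ 4 * \<kappa> / \<Delta>" by (simp add: power_divide)
    finally have "lp_cover p d C (\<lambda>x. x) \<Delta> (224 * p ^ 4 * \<kappa> / \<Delta>)"
      using lp_cover_mono lp_cover_dyadic[OF k n C order_refl d \<Delta>] unfolding \<kappa>_def by blast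
    then obtain W where "stochastic_cover C (\<lambda>S. \<forall>x\<in>S. \<forall>y\<in>S. lp_dist p d x y \<le> \<Delta>)
        (\<lambda>x y. 224 * p ^ 4 * \<kappa> / \<Delta> * lp_dist p d x y) W"
      unfolding lp_cover_def by (rule exE)
    from lipschitz_decomposition_of_stochastic_cover[OF C this, of "448 * p ^ 4 * \<kappa>"]
    show ?thesis by simp
  qed
qed simp

end
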